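(* Let $G$ be a connected linear semisimple real Lie group, $A$ a Cartan subspace of $G$, $A^+$ a closed Weyl chamber in $A$ and $\mu:G\to A^+$ the Cartan projection. Let $H_1,H_2$ be two closed subgroups of $G$. Then $H_1$ acts properly on $G/H_2$ if and only if for every compact subset $M$ of $A$, the set $\mu(H_1)\cap \mu(H_2)M$ is compact.
   Context: A Cartan subspace of $G$ is a connected abelian subgroup composed of hyperbolic elements and maximal for these properties. $\Sigma^+$ is a choice of positive roots in the restricted root system of $A$ in $G$, and $A^+:=\{a\in A : \chi(a)\ge 1 \text{ for all } \chi\in\Sigma^+\}$ (roots viewed as characters $A\to(0,\infty)$). $K$ is a maximal compact subgroup of $G$ for which the Cartan decomposition $G=KA^+K$ holds, and the Cartan projection $\mu(g)$ of $g\in G$ is the unique element of $KgK\cap A^+$. $H_1$ acts properly on $X=G/H_2$ if for every compact $L\subset X$ the set $\{h\in H_1 : hL\cap L\ne\emptyset\}$ is compact. *)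

theory Defs
  imports "HOL-Analysis.Analysis" "HOL-Algebra.Coset"
begin

section \<open>Linear groups and their Lie algebras\<close>

definition GL :: "(real^'n^'n) monoid" where
  "GL = \<lparr>carrier = {g. invertible g}, mult = (**), one = mat 1\<rparr>"

text \<open>The multiplication \<open>*\<close> and the power \<open>^\<close> of the library act componentwise on
  \<open>real^'n^'n\<close>, so powers and the exponential of matrices are written out via \<open>**\<close>.\<close>

definition matrix_exp :: "real^'n^'n \<Rightarrow> real^'n^'n" where
  "matrix_exp X = (\<Sum>k. (1 / fact k) *\<^sub>R (((**) X ^^ k) (mat 1)))"

definition lie_algebra :: "(real^'n^'n) set \<Rightarrow> (real^'n^'n) set" where
  "lie_algebra G = {X. \<forall>t::real. matrix_exp (t *\<^sub>R X) \<in> G}"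

definition lie_bracket :: "real^'n^'n \<Rightarrow> real^'n^'n \<Rightarrow> real^'n^'n" where
  "lie_bracket X Y = X ** Y - Y ** X"

definition lie_ideal :: "(real^'n^'n) set \<Rightarrow> (real^'n^'n) set \<Rightarrow> bool" where
  "lie_ideal I L \<longleftrightarrow> subspace I \<and> I \<subseteq> L \<and> (\<forall>X\<in>L. \<forall>Y\<in>I. lie_bracket X Y \<in> I)"

definition derived_algebra :: "(real^'n^'n) set \<Rightarrow> (real^'n^'n) set" where
  "derived_algebra L = span {lie_bracket X Y | X Y. X \<in> L \<and> Y \<in> L}"

definition solvable_lie_algebra :: "(real^'n^'n) set \<Rightarrow> bool" where
  "solvable_lie_algebra L \<longleftrightarrow> (\<exists>k. (derived_algebra ^^ k) L = {0})"

definition semisimple_lie_algebra :: "(real^'n^'n) set \<Rightarrow> bool" where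
  "semisimple_lie_algebra L \<longleftrightarrow>
     (\<forall>I. lie_ideal I L \<and> solvable_lie_algebra I \<longrightarrow> I = {0})"

text \<open>A linear Lie group is a closed subgroup of some \<open>GL(n,\<real>)\<close>, with the subspace topology.\<close>

definition connected_linear_semisimple_group :: "(real^'n^'n) set \<Rightarrow> bool" where
  "connected_linear_semisimple_group G \<longleftrightarrow>
     subgroup G GL \<and> closedin (top_of_set (carrier GL)) G \<and> connected G \<and>
     semisimple_lie_algebra (lie_algebra G)"

definition closed_subgroup :: "(real^'n^'n) set \<Rightarrow> (real^'n^'n) set \<Rightarrow> bool" where
  "closed_subgroup H G \<longleftrightarrow> subgroup H GL \<and> H \<subseteq> G \<and> closedin (top_of_set G) H"


section \<open>Cartan subspaces, restricted roots and Weyl chambers\<close>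

text \<open>Hyperbolic: diagonalizable over \<open>\<real>\<close> with positive eigenvalues.\<close>

definition hyperbolic :: "real^'n^'n \<Rightarrow> bool" where
  "hyperbolic g \<longleftrightarrow>
     (\<exists>P D :: real^'n^'n. invertible P \<and> (\<forall>i j. i \<noteq> j \<longrightarrow> D $ i $ j = 0) \<and> (\<forall>i. D $ i $ i > 0) \<and>
            g = P ** D ** matrix_inv P)"

definition connected_abelian_hyperbolic :: "(real^'n^'n) set \<Rightarrow> (real^'n^'n) set \<Rightarrow> bool" where
  "connected_abelian_hyperbolic G A \<longleftrightarrow>
     subgroup A GL \<and> A \<subseteq> G \<and> connected A \<and> (\<forall>a\<in>A. \<forall>b\<in>A. a ** b = b ** a) \<and>
     (\<forall>a\<in>A. hyperbolic a)"

definition cartan_subspace :: "(real^'n^'n) set \<Rightarrow> (real^'n^'n) set \<Rightarrow> bool" where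
  "cartan_subspace G A \<longleftrightarrow>
     connected_abelian_hyperbolic G A \<and>
     (\<forall>B. connected_abelian_hyperbolic G B \<and> A \<subseteq> B \<longrightarrow> B = A)"

text \<open>Roots are the nontrivial characters \<open>\<alpha> : A \<rightarrow> (0,\<infinity>)\<close> with a nonzero simultaneous
  eigenspace in the Lie algebra under the adjoint action; multiplicativity of \<open>\<alpha>\<close> follows from
  the eigenvector equation.  As functions on \<open>A\<close> they are taken to be \<^const>\<open>undefined\<close> outside \<open>A\<close>.\<close>

definition restricted_roots :: "(real^'n^'n) set \<Rightarrow> (real^'n^'n) set \<Rightarrow> (real^'n^'n \<Rightarrow> real) set" where
  "restricted_roots G A =
     {\<alpha> \<in> A \<rightarrow>\<^sub>E {0<..}. (\<exists>a\<in>A. \<alpha> a \<noteq> 1) \<and>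
        (\<exists>X \<in> lie_algebra G. X \<noteq> 0 \<and> (\<forall>a\<in>A. a ** X ** matrix_inv a = \<alpha> a *\<^sub>R X))}"

text \<open>A choice of positive roots consists of the roots on one side of a hyperplane containing no
  root; the hyperplane is given by a regular element \<open>a\<^sub>0\<close> of \<open>A\<close>.\<close>

definition positive_roots ::
    "(real^'n^'n) set \<Rightarrow> (real^'n^'n) set \<Rightarrow> (real^'n^'n \<Rightarrow> real) set \<Rightarrow> bool" where
  "positive_roots G A \<Sigma>p \<longleftrightarrow>
     (\<exists>a\<^sub>0\<in>A. (\<forall>\<alpha> \<in> restricted_roots G A. \<alpha> a\<^sub>0 \<noteq> 1) \<and>
             \<Sigma>p = {\<alpha> \<in> restricted_roots G A. \<alpha> a\<^sub>0 > 1})"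

definition weyl_chamber :: "(real^'n^'n) set \<Rightarrow> (real^'n^'n \<Rightarrow> real) set \<Rightarrow> (real^'n^'n) set" where
  "weyl_chamber A \<Sigma>p = {a \<in> A. \<forall>\<alpha>\<in>\<Sigma>p. \<alpha> a \<ge> 1}"


section \<open>Cartan decomposition and projection\<close>

definition maximal_compact_subgroup :: "(real^'n^'n) set \<Rightarrow> (real^'n^'n) set \<Rightarrow> bool" where
  "maximal_compact_subgroup G K \<longleftrightarrow>
     subgroup K GL \<and> K \<subseteq> G \<and> compact K \<and>
     (\<forall>K'. subgroup K' GL \<and> K' \<subseteq> G \<and> compact K' \<and> K \<subseteq> K' \<longrightarrow> K' = K)"

definition cartan_decomposition ::
    "(real^'n^'n) set \<Rightarrow> (real^'n^'n) set \<Rightarrow> (real^'n^'n) set \<Rightarrow> bool" where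
  "cartan_decomposition G K Ap \<longleftrightarrow> G = K <#>\<^bsub>GL\<^esub> Ap <#>\<^bsub>GL\<^esub> K"

text \<open>For \<open>g \<in> G\<close>, the value \<open>\<mu> g\<close> is the unique element of \<open>K g K \<inter> A\<^sup>+\<close>.\<close>

definition cartan_projection ::
    "(real^'n^'n) set \<Rightarrow> (real^'n^'n) set \<Rightarrow> (real^'n^'n) set \<Rightarrow> (real^'n^'n \<Rightarrow> real^'n^'n) \<Rightarrow> bool" where
  "cartan_projection G K Ap \<mu> \<longleftrightarrow>
     (\<forall>g\<in>G. (K <#>\<^bsub>GL\<^esub> {g} <#>\<^bsub>GL\<^esub> K) \<inter> Ap = {\<mu> g})"


section \<open>Homogeneous spaces and proper actions\<close>

definition coset_space :: "(real^'n^'n) set \<Rightarrow> (real^'n^'n) set \<Rightarrow> (real^'n^'n) set set" where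
  "coset_space G H = (\<lambda>g. g <#\<^bsub>GL\<^esub> H) ` G"

definition coset_topology :: "(real^'n^'n) set \<Rightarrow> (real^'n^'n) set \<Rightarrow> (real^'n^'n) set topology" where
  "coset_topology G H = topology (\<lambda>U. U \<subseteq> coset_space G H \<and>
     openin (top_of_set G) {g \<in> G. g <#\<^bsub>GL\<^esub> H \<in> U})"

definition acts_properly ::
    "(real^'n^'n) set \<Rightarrow> (real^'n^'n) set \<Rightarrow> (real^'n^'n) set \<Rightarrow> bool" where
  "acts_properly G H1 H2 \<longleftrightarrow>
     (\<forall>L. compactin (coset_topology G H2) L \<longrightarrow>
        compact {h \<in> H1. (\<lambda>C. h <#\<^bsub>GL\<^esub> C) ` L \<inter> L \<noteq> {}})"

lemma group_GL: "group (GL :: (real^'n^'n) monoid)"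
proof (rule groupI)
  fix x :: "real^'n^'n"
  assume "x \<in> carrier GL"
  then show "\<exists>y\<in>carrier GL. y \<otimes>\<^bsub>GL\<^esub> x = \<one>\<^bsub>GL\<^esub>"
    by (auto simp: GL_def invertible_def)
next
  have "invertible (mat 1 :: real^'n^'n)"
    using matrix_mul_lid[of "mat 1 :: real^'n^'n"] unfolding invertible_def by blast
  then show "\<one>\<^bsub>GL\<^esub> \<in> carrier (GL :: (real^'n^'n) monoid)"
    by (simp add: GL_def)
qed (simp_all add: GL_def invertible_mult matrix_mul_assoc)

lemma openin_coset_topology:
  "openin (coset_topology G H) U \<longleftrightarrow>
     U \<subseteq> coset_space G H \<and> openin (top_of_set G) {g \<in> G. g <#\<^bsub>GL\<^esub> H \<in> U}"
proof -
  have "istopology (\<lambda>U. U \<subseteq> coset_space G H \<and> openin (top_of_set G) {g \<in> G. g <#\<^bsub>GL\<^esub> H \<in> U})"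
    unfolding istopology_def
  proof (intro conjI allI impI; (elim conjE)?)
    fix S T
    assume "openin (top_of_set G) {g \<in> G. g <#\<^bsub>GL\<^esub> H \<in> S}"
      and "openin (top_of_set G) {g \<in> G. g <#\<^bsub>GL\<^esub> H \<in> T}"
    moreover have "{g \<in> G. g <#\<^bsub>GL\<^esub> H \<in> S \<inter> T} =
        {g \<in> G. g <#\<^bsub>GL\<^esub> H \<in> S} \<inter> {g \<in> G. g <#\<^bsub>GL\<^esub> H \<in> T}" by blast
    ultimately show "openin (top_of_set G) {g \<in> G. g <#\<^bsub>GL\<^esub> H \<in> S \<inter> T}"
      by (simp only: openin_Int)
  next
    fix \<K>
    assume *: "\<forall>S\<in>\<K>. S \<subseteq> coset_space G H \<and> openin (top_of_set G) {g \<in> G. g <#\<^bsub>GL\<^esub> H \<in> S}"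
    have "{g \<in> G. g <#\<^bsub>GL\<^esub> H \<in> \<Union> \<K>} = (\<Union>S\<in>\<K>. {g \<in> G. g <#\<^bsub>GL\<^esub> H \<in> S})" by blast
    then show "openin (top_of_set G) {g \<in> G. g <#\<^bsub>GL\<^esub> H \<in> \<Union> \<K>}"
      using * by (simp only:) (rule openin_Union, blast)
  qed blast+
  then show ?thesis
    by (simp add: coset_topology_def)
qed

lemma quotient_map_coset_topology:
  "quotient_map (top_of_set G) (coset_topology G H) (\<lambda>g. g <#\<^bsub>GL\<^esub> H)"
proof -
  have "{g \<in> G. g <#\<^bsub>GL\<^esub> H \<in> coset_space G H} = G"
    by (auto simp: coset_space_def)
  then have "openin (coset_topology G H) (coset_space G H)"
    by (simp add: openin_coset_topology)
  then have top: "topspace (coset_topology G H) = coset_space G H"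
    by (meson openin_coset_topology openin_subset openin_topspace subset_antisym)
  show ?thesis
    unfolding quotient_map_def top
    by (simp add: openin_coset_topology) (simp add: coset_space_def)
qed

end

theory Submission
  imports Defs
begin

text \<open>Both sides of the equivalence are turned into statements about compact subsets of \<open>G\<close>.

  On the left, every compact subset of \<open>G/H\<^sub>2\<close> is the image of a compact \<open>L \<subseteq> G\<close>, and \<open>h\<close> moves
  \<open>L H\<^sub>2\<close> so as to meet itself exactly when \<open>h \<in> L H\<^sub>2 L\<^sup>-\<^sup>1\<close>. Hence the action is proper iff
  \<open>H\<^sub>1 \<inter> L H\<^sub>2 L\<^sup>-\<^sup>1\<close> is compact for every compact \<open>L\<close> (\<open>acts_properly_iff\<close>).

  On the right, \<open>\<mu>\<close> is continuous and \<open>g \<in> K \<mu>(g) K\<close> with \<open>K\<close> compact, so that boundedness can be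
  tested after applying \<open>\<mu>\<close>. If \<open>\<mu>(h\<^sub>1) = \<mu>(h\<^sub>2) m\<close> with \<open>m \<in> M\<close>, then \<open>h\<^sub>1 \<in> K h\<^sub>2 (K M K)\<close>; so
  properness bounds \<open>\<mu>(H\<^sub>1) \<inter> \<mu>(H\<^sub>2) M\<close>. Conversely, if \<open>h\<^sub>1 \<in> L h\<^sub>2 L\<^sup>-\<^sup>1\<close>, then \<open>\<mu>(h\<^sub>1)\<close> has to be
  found in \<open>\<mu>(h\<^sub>2) M\<close> for some compact \<open>M \<subseteq> A\<close> depending on \<open>L\<close> only. This is the
  heart of the matter: \<open>\<mu>(L g L) \<subseteq> \<mu>(g) M\<close> for all \<open>g \<in> G\<close> (\<open>mu_mult_bounded\<close>).

  The estimate is usually deduced from the fundamental representations of \<open>G\<close> or from the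
  geometry of its symmetric space. Here it follows from a connectedness argument. In a
  suitable basis, a Cartan subspace consists of diagonal matrices and is the exponential of a vector
  space of such matrices (\<open>cartan_subspace_torus\<close>). As \<open>\<mu>\<close> is invariant under \<open>K\<close> on both sides, one may
  replace \<open>g\<close> by a point of \<open>K g K\<close> and the two factors from \<open>L\<close> by elements \<open>b\<close> and \<open>c\<close> of a
  bounded part of \<open>A\<close>; these are joined to the identity by one-parameter segments \<open>b\<^sub>s\<close> and \<open>c\<^sub>s\<close> that
  stay bounded. The matrices \<open>\<mu>(b\<^sub>s g c\<^sub>s)\<close> and \<open>\<mu>(g)\<close> differ by
  bounded factors on the left and on the right, and a dimension count shows that every diagonal entry
  of the former is, up to a bounded factor, one of the \<open>n\<close> entries of the latter
  (\<open>diagonal_entry_near_some_entry\<close>). A priori the entries could be permuted, which would allow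
  \<open>\<mu>\<close> to jump far away. But each logarithmic coordinate of \<open>\<mu>(b\<^sub>s g c\<^sub>s)\<close> moves continuously with
  \<open>s\<close> inside a union of \<open>n\<close> intervals of fixed length, so in total it moves by at most the sum of these
  lengths.\<close>

section \<open>Compactness in the general linear group\<close>

lemma continuous_on_matrix_mult [continuous_intros]:
  fixes f g :: "'a::topological_space \<Rightarrow> real^'n^'n"
  assumes "continuous_on S f" "continuous_on S g"
  shows "continuous_on S (\<lambda>x. f x ** g x)"
proof -
  have "bilinear (\<lambda>a b :: real^'n^'n. a ** b)"
    by (auto simp: bilinear_def linear_iff matrix_add_ldistrib vec_eq_iff matrix_matrix_mult_def sum.distrib
        algebra_simps sum_distrib_left)
  then show ?thesis
    using assms bilinear_conv_bounded_bilinear bounded_bilinear.continuous_on by blast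
qed

lemma continuous_on_det [continuous_intros]:
  fixes f :: "'a::topological_space \<Rightarrow> real^'n^'n"
  assumes "continuous_on S f"
  shows "continuous_on S (\<lambda>x. det (f x))"
  unfolding det_def using assms by (intro continuous_intros)

lemma matrix_inv_mult [simp]:
  assumes "invertible (a :: real^'n^'n)"
  shows "matrix_inv a ** a = mat 1" "a ** matrix_inv a = mat 1"
  using someI_ex[OF assms[unfolded invertible_def]] by (auto simp: matrix_inv_def)

lemma matrix_inv_unique:
  fixes a b :: "real^'n^'n"
  assumes "a ** b = mat 1"
  shows "matrix_inv a = b"
proof -
  have "invertible a"
    using assms invertible_right_inverse by blast
  then have "matrix_inv a ** (a ** b) = b"
    by (simp add: matrix_mul_assoc)
  then show ?thesis
    by (simp add: assms)
qed

text \<open>By Cramer's rule the entries of the inverse are quotients of determinants.\<close>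

lemma continuous_on_matrix_inv [continuous_intros]:
  fixes f :: "'a::topological_space \<Rightarrow> real^'n^'n"
  assumes "continuous_on S f" and "\<And>x. x \<in> S \<Longrightarrow> invertible (f x)"
  shows "continuous_on S (\<lambda>x. matrix_inv (f x))"
proof -
  have "matrix_inv (f x) $ k $ l =
      det (\<chi> i j. if j = k then axis l 1 $ i else f x $ i $ j) / det (f x)" if "x \<in> S" for x k l
  proof -
    have "f x *v (matrix_inv (f x) *v axis l 1) = axis l 1"
      using assms(2)[OF that] by (simp add: matrix_vector_mul_assoc)
    then show ?thesis
      using cramer[of "f x" "matrix_inv (f x) *v axis l 1" "axis l 1"] assms(2)[OF that]
      by (simp add: invertible_det_nz matrix_vector_mul_component column_def vec_eq_iff matrix_vector_mult_basis)
  qed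
  moreover have "continuous_on S
      (\<lambda>x. \<chi> k l. det (\<chi> i j. if j = k then axis l 1 $ i else f x $ i $ j) / det (f x))"
  proof -
    have "continuous_on S (\<lambda>x. if j = k then axis l 1 $ i else f x $ i $ j)" for i j k l
      using assms(1) by (cases "j = k") (auto intro!: continuous_intros)
    then show ?thesis
      using assms by (intro continuous_intros) (auto simp: invertible_det_nz)
  qed
  ultimately show ?thesis
    by (subst continuous_on_cong[OF refl,
          where g = "\<lambda>x. \<chi> k l. det (\<chi> i j. if j = k then axis l 1 $ i else f x $ i $ j) / det (f x)"])
      (simp_all add: vec_eq_iff)
qed

lemma compact_mult:
  fixes X Y :: "(real^'n^'n) set"
  assumes "compact X" "compact Y"
  shows "compact (X <#>\<^bsub>GL\<^esub> Y)"
proof -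
  have "X <#>\<^bsub>GL\<^esub> Y = (\<lambda>(x, y). x ** y) ` (X \<times> Y)"
    by (auto simp: set_mult_def GL_def)
  moreover have "continuous_on (X \<times> Y) (\<lambda>(x, y). x ** y)"
    unfolding split_def by (intro continuous_intros)
  ultimately show ?thesis
    using assms by (simp add: compact_Times compact_continuous_image)
qed

lemma compact_inv:
  fixes X :: "(real^'n^'n) set"
  assumes "compact X" "X \<subseteq> carrier GL"
  shows "compact (matrix_inv ` X)"
  using assms by (intro compact_continuous_image continuous_on_matrix_inv continuous_on_id) (auto simp: GL_def)

lemma compact_Int_closedin:
  assumes "closedin (top_of_set U) S" "compact X" "X \<subseteq> U"
  shows "compact (X \<inter> S)"
proof -
  obtain T where "closed T" "S = U \<inter> T"
    using assms(1) by (auto simp: closedin_closed)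
  then show ?thesis
    using assms(2,3) by (metis Int_absorb2 Int_assoc compact_Int_closed)
qed

lemma compact_matrices_bound:
  fixes X :: "(real^'n^'n) set"
  assumes "compact X"
  obtains c where "c \<ge> 1" "\<And>x v. x \<in> X \<Longrightarrow> norm (x *v v) \<le> c * norm v"
proof -
  have "bilinear (\<lambda>(a :: real^'n^'n) b. a *v b)"
    by (auto simp: bilinear_def linear_iff algebra_simps scaleR_matrix_vector_assoc[symmetric])
  then obtain k where k: "k > 0" "\<And>(a :: real^'n^'n) b. norm (a *v b) \<le> norm a * norm b * k"
    using bilinear_conv_bounded_bilinear bounded_bilinear.pos_bounded by metis
  obtain b where b: "\<And>x. x \<in> X \<Longrightarrow> norm x \<le> b" "b > 0"
    using compact_imp_bounded[OF assms] by (meson bounded_pos)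
  show thesis
  proof
    fix x and v :: "real^'n" assume "x \<in> X"
    then have "norm x * norm v * k \<le> b * norm v * k"
      using b k by (intro mult_right_mono) auto
    also have "\<dots> \<le> max 1 (b * k) * norm v"
      using mult_right_mono[of "b * k" "max 1 (b * k)" "norm v"] by (simp add: mult.commute mult.left_commute)
    finally show "norm (x *v v) \<le> max 1 (b * k) * norm v"
      using k(2)[of x v] by linarith
  qed simp
qed

lemma GL_mult [simp]: "x \<otimes>\<^bsub>GL\<^esub> y = x ** y" and GL_one [simp]: "\<one>\<^bsub>GL\<^esub> = mat 1"
  and GL_carrier [simp]: "x \<in> carrier GL \<longleftrightarrow> invertible x"
  by (simp_all add: GL_def)

lemma GL_inv [simp]:
  assumes "invertible (x :: real^'n^'n)"
  shows "inv\<^bsub>GL\<^esub> x = matrix_inv x"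
proof -
  have "invertible (matrix_inv x)"
    using assms matrix_inv_mult invertible_def by blast
  then show ?thesis
    using group.inv_equality[OF group_GL, of "matrix_inv x" x] assms by simp
qed

lemma subgroup_GL_iff:
  fixes H :: "(real^'n^'n) set"
  shows "subgroup H GL \<longleftrightarrow> (\<forall>x\<in>H. invertible x) \<and> mat 1 \<in> H \<and>
    (\<forall>x\<in>H. \<forall>y\<in>H. x ** y \<in> H) \<and> (\<forall>x\<in>H. matrix_inv x \<in> H)"
  unfolding subgroup_def by (auto simp: subset_iff)

lemma mem_set_mult_GL: "x \<in> X <#>\<^bsub>GL\<^esub> Y \<longleftrightarrow> (\<exists>a\<in>X. \<exists>b\<in>Y. x = a ** b)"
  by (auto simp: set_mult_def)

lemma mem_set_mult3_GL:
  "x \<in> X <#>\<^bsub>GL\<^esub> Y <#>\<^bsub>GL\<^esub> Z \<longleftrightarrow> (\<exists>a\<in>X. \<exists>b\<in>Y. \<exists>c\<in>Z. x = a ** b ** c)"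
  unfolding Bex_def mem_set_mult_GL by blast

section \<open>Comparable diagonal matrices\<close>

definition diag :: "real^'n \<Rightarrow> real^'n^'n" where
  "diag d = (\<chi> i j. if i = j then d $ i else 0)"

lemma diag_nth: "(diag d ** m) $ i $ j = d $ i * m $ i $ j" "(m ** diag d) $ i $ j = m $ i $ j * d $ j"
  by (simp_all add: diag_def matrix_matrix_mult_def if_distrib[of "\<lambda>x. x * _"] if_distrib[of "\<lambda>x. _ * x"] cong: if_cong)

lemma diag_mult_vec_nth: "(diag d *v v) $ i = d $ i * v $ i"
  by (simp add: diag_def matrix_vector_mult_def if_distrib[of "\<lambda>x. x * _"] cong: if_cong)

lemma diag_mult: "diag d ** diag e = diag (\<chi> i. d $ i * e $ i)"
  by (simp add: diag_nth vec_eq_iff) (simp add: diag_def)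

lemma norm_le_mult_componentwise:
  fixes u v :: "real^'n"
  assumes "\<And>i. \<bar>u $ i\<bar> \<le> c * \<bar>v $ i\<bar>" "c \<ge> 0"
  shows "norm u \<le> c * norm v"
proof -
  have "norm u \<le> norm (c *\<^sub>R v)"
    using assms by (intro norm_le_componentwise_cart) (simp add: abs_mult)
  then show ?thesis using assms by simp
qed

text \<open>A weak form of the minimax principle for singular values. The coordinate subspace of the large
  entries of \<open>d'\<close>, transported by \<open>U\<close>, meets the coordinate subspace of the small entries of \<open>d\<close> only
  in \<open>0\<close>: on a nonzero common vector \<open>diag d ** W\<close> would be smaller than \<open>U ** diag d'\<close> permits.\<close>

lemma card_large_diagonal_entries_le:
  fixes U W :: "real^'n^'n"
  assumes eq: "U ** diag d' = diag d ** W"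
    and pos: "\<And>i. d $ i > 0" "\<And>i. d' $ i > 0"
    and U: "\<And>v. norm v \<le> c * norm (U *v v)" and W: "\<And>v. norm (W *v v) \<le> c * norm v"
    and t: "t > 0" and c: "c \<ge> 1"
  shows "card {i. d' $ i \<ge> t} \<le> card {j. d $ j \<ge> t / c\<^sup>2}"
proof (rule ccontr)
  define B where "B = {j. d $ j \<ge> t / c\<^sup>2}"
  define I where "I = {i. d' $ i \<ge> t}"
  assume "\<not> ?thesis"
  then have gt: "card I > card B"
    by (simp add: B_def I_def)
  define E where "E = {v :: real^'n. \<forall>i. i \<notin> I \<longrightarrow> v $ i = 0}"
  define F where "F = {v :: real^'n. \<forall>i. i \<notin> - B \<longrightarrow> v $ i = 0}"
  have linU: "linear ((*v) U)" by simp
  have injU: "inj ((*v) U)"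
  proof (rule injI)
    fix x y assume "U *v x = U *v y"
    then have "U *v (x - y) = 0" by (simp add: algebra_simps)
    then show "x = y" using U[of "x - y"] by simp
  qed
  have sE: "subspace E" and sF: "subspace F"
    by (auto simp: subspace_def E_def F_def)
  have sUE: "subspace ((*v) U ` E)"
    using linU sE linear_subspace_image by blast
  have "dim E = card I" "dim F = card (- B)"
    unfolding E_def F_def dim_vec_eq[symmetric] by (rule dim_substandard_cart)+
  moreover have "dim ((*v) U ` E) = dim E"
    using injU by (intro dim_image_eq[OF linU]) (auto intro: inj_on_subset)
  moreover have "card (- B) = CARD('n) - card B"
    by (metis Compl_eq_Diff_UNIV card_Diff_subset finite subset_UNIV)
  moreover have "dim {x + y |x y. x \<in> (*v) U ` E \<and> y \<in> F} \<le> CARD('n)"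
    by (rule dim_subset_UNIV_cart)
  moreover have "card B \<le> CARD('n)"
    by (simp add: card_mono)
  \<comment> \<open>the dimensions of the two subspaces add up to more than \<open>n\<close>\<close>
  ultimately have "dim ((*v) U ` E \<inter> F) > 0"
    using dim_sums_Int[OF sUE sF] gt by linarith
  then obtain x where x: "x \<in> (*v) U ` E \<inter> F" "x \<noteq> 0"
    by (metis dim_eq_0 less_numeral_extra(3) singletonI subsetI)
  then obtain y where y: "y \<in> E" "x = U *v y"
    by auto
  \<comment> \<open>now \<open>x = U (diag d') z = (diag d) W z\<close> can be estimated in two ways\<close>
  define z where "z = (\<chi> i. y $ i / d' $ i)"
  have "y = diag d' *v z"
    using pos(2) by (simp add: vec_eq_iff diag_mult_vec_nth z_def less_imp_neq[symmetric])
  then have xz: "x = diag d *v (W *v z)"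
    using y(2) eq by (metis matrix_vector_mul_assoc)
  have "norm z \<le> (1 / t) * norm y"
  proof (rule norm_le_mult_componentwise)
    fix i show "\<bar>z $ i\<bar> \<le> 1 / t * \<bar>y $ i\<bar>"
    proof (cases "i \<in> I")
      case True
      then have "t \<le> d' $ i" by (simp add: I_def)
      then show ?thesis
        using t pos(2)[of i] by (simp add: z_def abs_div frac_le)
    next
      case False
      then show ?thesis using y(1) by (simp add: E_def z_def)
    qed
  qed (use t in simp)
  then have Wz: "norm (W *v z) \<le> c * (norm y / t)"
    using W[of z] c mult_left_mono[of "norm z" "norm y / t" c] by simp
  define q where "q = t / c\<^sup>2"
  have q: "q > 0" using t c by (simp add: q_def)
  have small: "x $ i = 0 \<or> d $ i < q" for i
    using x(1) by (auto simp: F_def B_def q_def)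
  have absx: "\<bar>x $ i\<bar> = d $ i * \<bar>(W *v z) $ i\<bar>" for i
    using pos(1)[of i] by (simp add: xz diag_mult_vec_nth abs_mult)
  have "norm x < norm (q *\<^sub>R (W *v z))"
  proof -
    have entry: "\<bar>x $ i\<bar> \<le> q * \<bar>(W *v z) $ i\<bar>" for i
    proof (cases "x $ i = 0")
      case False
      then have "d $ i \<le> q"
        using small[of i] by simp
      then show ?thesis
        by (simp add: absx mult_right_mono)
    qed (use q in simp)
    obtain i where i: "x $ i \<noteq> 0"
      using x(2) by (auto simp: vec_eq_iff)
    then have "(W *v z) $ i \<noteq> 0"
      using absx[of i] by auto
    then have strict: "\<bar>x $ i\<bar> < q * \<bar>(W *v z) $ i\<bar>"
      using small[of i] i by (auto simp: absx)
    have "(\<Sum>k\<in>UNIV. \<bar>x $ k\<bar>\<^sup>2) < (\<Sum>k\<in>UNIV. (q * \<bar>(W *v z) $ k\<bar>)\<^sup>2)"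
    proof (rule sum_strict_mono_ex1)
      show "\<forall>k\<in>UNIV. \<bar>x $ k\<bar>\<^sup>2 \<le> (q * \<bar>(W *v z) $ k\<bar>)\<^sup>2"
        using entry by (intro ballI power_mono) auto
      show "\<exists>k\<in>UNIV. \<bar>x $ k\<bar>\<^sup>2 < (q * \<bar>(W *v z) $ k\<bar>)\<^sup>2"
        using strict by (intro bexI[of _ i] power_strict_mono) auto
    qed simp
    then show ?thesis
      using q by (simp add: norm_vec_def L2_set_def abs_mult)
  qed
  then have "norm x < t / c\<^sup>2 * norm (W *v z)"
    using t q by (simp add: q_def)
  also have "\<dots> \<le> t / c\<^sup>2 * (c * (norm y / t))"
    using Wz t by (intro mult_left_mono) auto
  also have "\<dots> = norm y / c"
    using t c by (simp add: power2_eq_square)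
  finally show False
    using U[of y] y(2) c by (simp add: field_simps)
qed

text \<open>If no entry of \<open>d\<close> is near \<open>d' $ i\<close>, the entries of \<open>d\<close> fall into those well above and those
  well below it, \<open>n\<close> in total. By the previous lemma, applied also to the inverses, they are at least
  as numerous as the entries of \<open>d'\<close> that are \<open>\<ge> d' $ i\<close> and those that are \<open>\<le> d' $ i\<close>. But the
  latter two numbers add up to more than \<open>n\<close>, since \<open>i\<close> is counted twice.\<close>

lemma diagonal_entry_near_some_entry:
  fixes U W :: "real^'n^'n"
  assumes eq: "U ** diag d' = diag d ** W"
    and pos: "\<And>i. d $ i > 0" "\<And>i. d' $ i > 0"
    and U: "\<And>v. norm v \<le> c * norm (U *v v)" "\<And>v. norm (U *v v) \<le> c * norm v"
    and W: "\<And>v. norm v \<le> c * norm (W *v v)" "\<And>v. norm (W *v v) \<le> c * norm v"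
    and c: "c \<ge> 1"
  obtains j where "\<bar>ln (d' $ i) - ln (d $ j)\<bar> \<le> 2 * ln c"
proof -
  define t where "t = d' $ i"
  have t: "t > 0" using pos by (simp add: t_def)
  define e e' where "e = (\<chi> i. inverse (d $ i))" and "e' = (\<chi> i. inverse (d' $ i))"
  \<comment> \<open>inverting both diagonal matrices exchanges the roles of \<open>U\<close> and \<open>W\<close>, and of large and small\<close>
  have "W ** diag e' = diag e ** U"
  proof -
    have "U $ k $ l * d' $ l = d $ k * W $ k $ l" for k l
      using eq diag_nth[where m = U and d = d'] diag_nth[where m = W and d = d] by metis
    then show ?thesis
      using pos by (simp add: vec_eq_iff diag_nth e_def e'_def field_simps less_imp_neq[symmetric])
  qed
  then have "card {k. e' $ k \<ge> 1 / t} \<le> card {j. e $ j \<ge> (1 / t) / c\<^sup>2}"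
    using pos c t by (intro card_large_diagonal_entries_le[OF _ _ _ W(1) U(2)]) (auto simp: e_def e'_def)
  moreover have "{k. e' $ k \<ge> 1 / t} = {k. d' $ k \<le> t}" "{j. e $ j \<ge> (1 / t) / c\<^sup>2} = {j. d $ j \<le> c\<^sup>2 * t}"
    using pos t c by (auto simp: e_def e'_def field_simps)
  ultimately have lower: "card {k. d' $ k \<le> t} \<le> card {j. d $ j \<le> c\<^sup>2 * t}"
    by simp
  have upper: "card {k. d' $ k \<ge> t} \<le> card {j. d $ j \<ge> t / c\<^sup>2}"
    using card_large_diagonal_entries_le[OF eq pos U(1) W(2) t c] .
  have "{j. d $ j \<le> c\<^sup>2 * t} \<inter> {j. d $ j \<ge> t / c\<^sup>2} \<noteq> {}"
  proof
    assume "{j. d $ j \<le> c\<^sup>2 * t} \<inter> {j. d $ j \<ge> t / c\<^sup>2} = {}"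
    then have "card {j. d $ j \<le> c\<^sup>2 * t} + card {j. d $ j \<ge> t / c\<^sup>2} \<le> CARD('n)"
      by (subst card_Un_disjoint[symmetric]) (auto intro: card_mono)
    moreover have "card {k. d' $ k \<le> t} + card {k. d' $ k \<ge> t}
        = card ({k. d' $ k \<le> t} \<union> {k. d' $ k \<ge> t}) + card ({k. d' $ k \<le> t} \<inter> {k. d' $ k \<ge> t})"
      by (intro card_Un_Int) auto
    moreover have "{k. d' $ k \<le> t} \<union> {k. d' $ k \<ge> t} = UNIV"
      by auto
    then have "card ({k. d' $ k \<le> t} \<union> {k. d' $ k \<ge> t}) = CARD('n)"
      by simp
    moreover have "card ({k. d' $ k \<le> t} \<inter> {k. d' $ k \<ge> t}) > 0"
      by (subst card_gt_0_iff) (auto simp: t_def)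
    ultimately show False
      using lower upper by linarith
  qed
  then obtain j where j: "d $ j \<le> c\<^sup>2 * t" "t / c\<^sup>2 \<le> d $ j"
    by auto
  have ln2: "ln (c\<^sup>2) = 2 * ln c"
    using c by (simp add: ln_realpow)
  have "ln (d $ j) \<le> ln (c\<^sup>2 * t)" "ln (t / c\<^sup>2) \<le> ln (d $ j)"
    using j t c pos by (auto simp: ln_le_cancel_iff)
  then have "\<bar>ln t - ln (d $ j)\<bar> \<le> 2 * ln c"
    using t c by (simp add: ln_mult ln_div ln2)
  then show thesis
    using that t_def by blast
qed

text \<open>The interval between two points of \<open>T\<close> has measure at most the sum of the lengths of the covering
  intervals.\<close>

lemma connected_near_finite_set_bound:
  fixes T :: "real set"
  assumes T: "connected T" and cover: "T \<subseteq> (\<Union>i\<in>I. {p i - r .. p i + r})" and I: "finite I" and r: "r \<ge> 0"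
    and "x \<in> T" "y \<in> T"
  shows "\<bar>x - y\<bar> \<le> 2 * r * card I"
proof -
  have *: "y - x \<le> 2 * r * card I" if "x \<in> T" "y \<in> T" "x \<le> y" for x y
  proof -
    have "{x..y} \<subseteq> (\<Union>i\<in>I. {p i - r .. p i + r})"
      using T that cover connected_contains_Icc by blast
    then have "measure lborel {x..y} \<le> measure lborel (\<Union>i\<in>I. {p i - r .. p i + r})"
      using I by (intro measure_mono_fmeasurable fmeasurable_compact compact_UN) auto
    also have "\<dots> \<le> (\<Sum>i\<in>I. measure lborel {p i - r .. p i + r})"
      using I by (intro measure_UNION_le) auto
    finally show ?thesis
      using that r by (simp add: mult.commute)
  qed
  show ?thesis
    using *[of x y] *[of y x] assms(5,6) by (cases "x \<le> y") auto
qed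

section \<open>Simultaneous diagonalization of commuting hyperbolic matrices\<close>

text \<open>Applying \<open>a - m\<close> kills the component for the eigenvalue \<open>m\<close> and rescales the others by nonzero
  factors, which allows induction on the number of eigenvalues.\<close>

lemma eigencomponents_in_invariant_subspace:
  fixes a :: "real^'n^'n" and w :: "real \<Rightarrow> real^'n"
  assumes "finite \<Lambda>" and W: "subspace W" "\<And>v. v \<in> W \<Longrightarrow> a *v v \<in> W"
    and "\<And>l. l \<in> \<Lambda> \<Longrightarrow> a *v w l = l *\<^sub>R w l" and "(\<Sum>l\<in>\<Lambda>. w l) \<in> W"
  shows "\<forall>l\<in>\<Lambda>. w l \<in> W"
  using assms(1,4,5)
proof (induction \<Lambda> arbitrary: w)
  case (insert m \<Lambda>)
  let ?u = "\<Sum>l\<in>insert m \<Lambda>. w l"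
  have "a *v ?u = (\<Sum>l\<in>insert m \<Lambda>. l *\<^sub>R w l)"
    using insert.prems by (simp add: linear_sum[of "(*v) a"])
  then have "a *v ?u - m *\<^sub>R ?u = (\<Sum>l\<in>\<Lambda>. (l - m) *\<^sub>R w l)"
    using insert.hyps by (simp add: scaleR_sum_right sum_subtractf algebra_simps)
  moreover have "a *v ?u - m *\<^sub>R ?u \<in> W"
    using W insert.prems(2) by (intro subspace_diff subspace_scale) auto
  ultimately have "\<forall>l\<in>\<Lambda>. (l - m) *\<^sub>R w l \<in> W"
    using insert.prems(1) by (intro insert.IH) (auto simp: matrix_vector_mult_scaleR mult.commute)
  then have "inverse (l - m) *\<^sub>R ((l - m) *\<^sub>R w l) \<in> W" if "l \<in> \<Lambda>" for l
    using that W(1) subspace_scale by blast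
  moreover have "l \<noteq> m" if "l \<in> \<Lambda>" for l
    using that insert.hyps by auto
  ultimately have *: "\<forall>l\<in>\<Lambda>. w l \<in> W"
    by auto
  then have "(\<Sum>l\<in>\<Lambda>. w l) \<in> W"
    using W(1) by (intro subspace_sum) auto
  from subspace_diff[OF W(1) insert.prems(2) this] show ?case
    using * insert.hyps by simp
qed simp

lemma hyperbolic_eigen_decomposition:
  fixes g :: "real^'n^'n"
  assumes "hyperbolic g"
  obtains \<Lambda> w where "finite \<Lambda>" "\<And>l. l \<in> \<Lambda> \<Longrightarrow> l > 0" "\<And>l. l \<in> \<Lambda> \<Longrightarrow> g *v w l = l *\<^sub>R w l"
    "v = (\<Sum>l\<in>\<Lambda>. w l)"
proof -
  obtain P D :: "real^'n^'n" where P: "invertible P" and D: "\<forall>i j. i \<noteq> j \<longrightarrow> D $ i $ j = 0" "\<forall>i. D $ i $ i > 0"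
    and g: "g = P ** D ** matrix_inv P"
    using assms unfolding hyperbolic_def by blast
  define u where "u = matrix_inv P *v v"
  define w where "w l = P *v (\<chi> i. if D $ i $ i = l then u $ i else 0)" for l
  define \<Lambda> where "\<Lambda> = range (\<lambda>i. D $ i $ i)"
  have "D = diag (\<chi> i. D $ i $ i)"
    using D(1) by (simp add: diag_def vec_eq_iff)
  then have Dv: "D *v x = (\<chi> i. D $ i $ i * x $ i)" for x
    by (metis (no_types, lifting) diag_mult_vec_nth vec_lambda_beta vec_eq_iff)
  have "g *v w l = P *v (D *v ((matrix_inv P ** P) *v (\<chi> i. if D $ i $ i = l then u $ i else 0)))" for l
    by (simp add: g w_def matrix_vector_mul_assoc matrix_mul_assoc del: matrix_inv_mult)
  also have "\<dots> l = P *v (l *\<^sub>R (\<chi> i. if D $ i $ i = l then u $ i else 0))" for l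
  proof -
    have "(\<chi> i. D $ i $ i * (\<chi> i. if D $ i $ i = l then u $ i else 0) $ i)
        = l *\<^sub>R (\<chi> i. if D $ i $ i = l then u $ i else 0)"
      by (simp add: vec_eq_iff)
    then show ?thesis
      using P by (simp only: Dv matrix_inv_mult matrix_vector_mul_lid)
  qed
  finally have "g *v w l = l *\<^sub>R w l" for l
    by (simp add: w_def matrix_vector_mult_scaleR)
  moreover have "(\<Sum>l\<in>\<Lambda>. w l) = v"
  proof -
    have "(\<Sum>l\<in>\<Lambda>. w l) = P *v (\<Sum>l\<in>\<Lambda>. (\<chi> i. if D $ i $ i = l then u $ i else 0))"
      by (simp add: w_def linear_sum[of "(*v) P"])
    also have "(\<Sum>l\<in>\<Lambda>. (\<chi> i. if D $ i $ i = l then u $ i else 0)) = u"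
      by (simp add: vec_eq_iff sum.delta \<Lambda>_def)
    finally show ?thesis
      using P by (simp add: u_def matrix_vector_mul_assoc)
  qed
  ultimately show thesis
    using that[of \<Lambda> w] D(2) by (auto simp: \<Lambda>_def)
qed

text \<open>The line through an eigenvector is invariant, so it contains the components of that vector in the
  decomposition into eigenvectors with positive eigenvalues.\<close>

lemma hyperbolic_eigenvalue_pos:
  fixes g :: "real^'n^'n"
  assumes "hyperbolic g" and v: "v \<noteq> 0" "g *v v = c *\<^sub>R v"
  shows "c > 0"
proof -
  obtain \<Lambda> w where w: "finite \<Lambda>" "\<And>l. l \<in> \<Lambda> \<Longrightarrow> l > 0" "\<And>l. l \<in> \<Lambda> \<Longrightarrow> g *v w l = l *\<^sub>R w l"
    "v = (\<Sum>l\<in>\<Lambda>. w l)"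
    using hyperbolic_eigen_decomposition[OF assms(1)] by metis
  have "g *v x \<in> span {v}" if "x \<in> span {v}" for x
    using that v(2) by (auto simp: span_singleton matrix_vector_mult_scaleR)
  moreover have "(\<Sum>l\<in>\<Lambda>. w l) \<in> span {v}"
    by (simp add: w(4)[symmetric] span_base)
  ultimately have mem: "\<forall>l\<in>\<Lambda>. w l \<in> span {v}"
    using w(1,3) by (intro eigencomponents_in_invariant_subspace) auto
  obtain l where l: "l \<in> \<Lambda>" "w l \<noteq> 0"
    using v(1) w(4) by (metis sum.neutral)
  then obtain k where "w l = k *\<^sub>R v"
    using mem by (auto simp: span_singleton)
  then have "l *\<^sub>R w l = c *\<^sub>R w l"
    using w(3)[OF l(1)] v(2) by (auto simp: matrix_vector_mult_scaleR mult.commute)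
  then show ?thesis
    using l w(2) by (metis scaleR_right_imp_eq)
qed

text \<open>Induction on the dimension: if some \<open>a \<in> A\<close> is not scalar on \<open>W\<close>, then \<open>W\<close> is spanned by its
  intersections with the eigenspaces of \<open>a\<close>. These are smaller, and invariant under \<open>A\<close> by
  commutativity.\<close>

lemma joint_eigenvectors_span:
  fixes A :: "(real^'n^'n) set"
  assumes comm: "\<And>a b. a \<in> A \<Longrightarrow> b \<in> A \<Longrightarrow> a ** b = b ** a" and hyp: "\<And>a. a \<in> A \<Longrightarrow> hyperbolic a"
    and "subspace W" "\<And>a v. a \<in> A \<Longrightarrow> v \<in> W \<Longrightarrow> a *v v \<in> W"
  shows "W \<subseteq> span {v \<in> W. \<forall>a\<in>A. \<exists>c. a *v v = c *\<^sub>R v}"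
  using assms(3,4)
proof (induction "dim W" arbitrary: W rule: less_induct)
  case less
  show ?case
  proof (cases "\<forall>a\<in>A. \<exists>c. \<forall>v\<in>W. a *v v = c *\<^sub>R v")
    case True
    then have "W \<subseteq> {v \<in> W. \<forall>a\<in>A. \<exists>c. a *v v = c *\<^sub>R v}"
      by blast
    then show ?thesis
      using span_superset by blast
  next
    case False
    then obtain a where a: "a \<in> A" "\<And>c. \<exists>v\<in>W. a *v v \<noteq> c *\<^sub>R v"
      by blast
    show ?thesis
    proof
      fix v assume v: "v \<in> W"
      obtain \<Lambda> w where w: "finite \<Lambda>" "\<And>l. l \<in> \<Lambda> \<Longrightarrow> a *v w l = l *\<^sub>R w l" "v = (\<Sum>l\<in>\<Lambda>. w l)"
        using hyperbolic_eigen_decomposition[OF hyp[OF a(1)]] by metis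
      have wW: "\<forall>l\<in>\<Lambda>. w l \<in> W"
        using w v a(1) less.prems by (intro eigencomponents_in_invariant_subspace[where a = a]) auto
      have "w l \<in> span {v \<in> W. \<forall>a\<in>A. \<exists>c. a *v v = c *\<^sub>R v}" if "l \<in> \<Lambda>" for l
      proof -
        define E where "E = {u \<in> W. a *v u = l *\<^sub>R u}"
        have E: "subspace E"
          using less.prems(1) by (auto simp: E_def subspace_def algebra_simps)
        have "E \<subset> W"
          using a(2)[of l] by (auto simp: E_def)
        then have "dim E < dim W"
          using E less.prems(1) by (intro dim_psubset) (simp add: span_eq_iff[THEN iffD2])
        moreover have "b *v u \<in> E" if "b \<in> A" "u \<in> E" for b u
        proof -
          have "a *v (b *v u) = b *v (a *v u)"
            using comm[OF a(1) that(1)] by (simp add: matrix_vector_mul_assoc)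
          then show ?thesis
            using that less.prems(2) by (simp add: E_def matrix_vector_mult_scaleR)
        qed
        ultimately have "E \<subseteq> span {v \<in> E. \<forall>a\<in>A. \<exists>c. a *v v = c *\<^sub>R v}"
          using less.hyps E by blast
        also have "\<dots> \<subseteq> span {v \<in> W. \<forall>a\<in>A. \<exists>c. a *v v = c *\<^sub>R v}"
          by (intro span_mono) (auto simp: E_def)
        finally show ?thesis
          using that w(2) wW by (auto simp: E_def)
      qed
      then show "v \<in> span {v \<in> W. \<forall>a\<in>A. \<exists>c. a *v v = c *\<^sub>R v}"
        unfolding w(3) by (intro span_sum) auto
    qed
  qed
qed

text \<open>The joint eigenvectors span the whole space, so a basis can be chosen among them.\<close>

lemma simultaneous_diagonalization:
  fixes A :: "(real^'n^'n) set"
  assumes comm: "\<And>a b. a \<in> A \<Longrightarrow> b \<in> A \<Longrightarrow> a ** b = b ** a" and hyp: "\<And>a. a \<in> A \<Longrightarrow> hyperbolic a"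
  obtains P :: "real^'n^'n" where "invertible P"
    "\<And>a. a \<in> A \<Longrightarrow> \<exists>d. (\<forall>i. d $ i > 0) \<and> a = P ** diag d ** matrix_inv P"
proof -
  define J where "J = {v. \<forall>a\<in>A. \<exists>c. a *v v = c *\<^sub>R v}"
  have J: "span J = UNIV"
    using joint_eigenvectors_span[of A UNIV] comm hyp by (auto simp: J_def)
  obtain B where B: "B \<subseteq> J" "independent B" "J \<subseteq> span B" "card B = dim J"
    using basis_exists by blast
  have "card B = CARD('n)"
    using B(4) J by (metis dim_span DIM_cart DIM_real dim_UNIV mult.right_neutral)
  moreover have finB: "finite B"
    using B(2) independent_bound by blast
  ultimately obtain f where f: "bij_betw f (UNIV :: 'n set) B"
    by (metis finite finite_same_card_bij)
  define P where "P = (\<chi> i j. f j $ i)"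
  have "columns P = B"
  proof -
    have "column j P = f j" for j
      by (simp add: column_def P_def vec_eq_iff)
    then show ?thesis
      using f by (auto simp: columns_def bij_betw_def)
  qed
  moreover have "span B = UNIV"
    using B(1,3) J by (metis span_eq top.extremum_uniqueI span_span span_mono)
  ultimately have "\<exists>Q. P ** Q = mat 1"
    by (simp add: matrix_right_invertible_span_columns span_vec_eq)
  then have P: "invertible P"
    by (simp add: invertible_right_inverse)
  have "\<exists>d. (\<forall>i. d $ i > 0) \<and> a = P ** diag d ** matrix_inv P" if a: "a \<in> A" for a
  proof -
    have "f j \<in> J" for j
      using f B(1) by (auto simp: bij_betw_def)
    then have "\<forall>j. \<exists>c. a *v f j = c *\<^sub>R f j"
      using a by (simp add: J_def)
    then obtain d where d: "\<And>j. a *v f j = d j *\<^sub>R f j"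
      by metis
    have "f j \<noteq> 0" for j
      using f B(2) dependent_zero by (metis UNIV_I bij_betwE)
    then have "d j > 0" for j
      using hyperbolic_eigenvalue_pos[OF hyp[OF a]] d by blast
    moreover have "a ** P = P ** diag (\<chi> j. d j)"
    proof -
      have "(a ** P) $ i $ j = (a *v f j) $ i" for i j
        by (simp add: matrix_matrix_mult_def matrix_vector_mult_def P_def)
      then show ?thesis
        by (simp add: vec_eq_iff d diag_nth) (simp add: P_def mult.commute)
    qed
    then have "P ** diag (\<chi> j. d j) ** matrix_inv P = a"
      using P by (metis matrix_inv_mult(2) matrix_mul_assoc matrix_mul_rid)
    ultimately show ?thesis
      by (intro exI[of _ "\<chi> j. d j"]) simp
  qed
  then show thesis
    using that[OF P] by simp
qed

section \<open>Cartan subspaces as exponentials of vector spaces\<close>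

text \<open>Let \<open>V\<close> be the largest subspace contained in \<open>S\<close>. If \<open>V\<close> were not open in \<open>S\<close>, there would be
  arbitrarily small nonzero \<open>z \<in> S\<close> orthogonal to \<open>V\<close>. Integer multiples of such \<open>z\<close> fill up, in the
  limit, a line in \<open>S\<close> orthogonal to \<open>V\<close>, contrary to the choice of \<open>V\<close>. So \<open>V\<close> is open and closed in
  the connected set \<open>S\<close>.\<close>

lemma closed_connected_additive_subgroup_imp_subspace:
  fixes S :: "'a::euclidean_space set"
  assumes "closed S" "connected S" and S0: "0 \<in> S" and S: "\<And>x y. x \<in> S \<Longrightarrow> y \<in> S \<Longrightarrow> x - y \<in> S"
  shows "subspace S"
proof -
  have neg: "- x \<in> S" if "x \<in> S" for x
    using S[OF S0 that] by simp
  have add: "x + y \<in> S" if "x \<in> S" "y \<in> S" for x y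
    using S[OF that(1) neg[OF that(2)]] by simp
  have nat_mult: "of_nat k *\<^sub>R x \<in> S" if "x \<in> S" for x k
    by (induction k) (auto simp: S0 add that scaleR_add_left)
  have int_mult: "of_int k *\<^sub>R x \<in> S" if "x \<in> S" for x k
    using nat_mult[OF that] neg by (cases k rule: int_cases2) (auto simp del: of_nat_Suc)
  define V where "V = {x. \<forall>t. t *\<^sub>R x \<in> S}"
  have V: "subspace V"
    by (auto simp: subspace_def V_def S0 add scaleR_add_right)
  have VS: "V \<subseteq> S"
    by (auto simp: V_def dest: spec[of _ 1])
  have "\<exists>\<delta>>0. \<forall>s\<in>S. norm s < \<delta> \<longrightarrow> s \<in> V"
  proof (rule ccontr)
    assume contra: "\<not> ?thesis"
    have "\<exists>z\<in>S. z \<noteq> 0 \<and> norm z < inverse (real (Suc n)) \<and> (\<forall>v\<in>V. orthogonal z v)" for n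
    proof -
      have "inverse (real (Suc n)) > 0" by simp
      then obtain s where s: "s \<in> S" "norm s < inverse (real (Suc n))" "s \<notin> V"
        using contra by meson
      obtain y z where yz: "y \<in> span V" "\<And>v. v \<in> span V \<Longrightarrow> orthogonal z v" "s = y + z"
        using orthogonal_subspace_decomp_exists[of V s] by blast
      have "y \<in> V"
        using yz(1) V by (simp add: span_eq_iff[THEN iffD2])
      moreover have "z = s - y"
        using yz(3) by simp
      ultimately have "z \<in> S" "z \<noteq> 0"
        using s S VS by auto
      moreover have "norm z \<le> norm s"
      proof -
        have "(norm s)\<^sup>2 = (norm y)\<^sup>2 + (norm z)\<^sup>2"
          using yz by (simp add: norm_add_Pythagorean orthogonal_commute)
        then have "(norm z)\<^sup>2 \<le> (norm s)\<^sup>2"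
          by simp
        then show ?thesis
          using norm_ge_zero power2_le_imp_le by blast
      qed
      ultimately show ?thesis
        using s(2) yz(2) span_base by (intro bexI[of _ z]) auto
    qed
    then obtain z where z: "\<And>n. z n \<in> S" "\<And>n. z n \<noteq> 0" "\<And>n. norm (z n) < inverse (real (Suc n))"
      "\<And>n v. v \<in> V \<Longrightarrow> orthogonal (z n) v"
      by metis
    have z_lim: "(\<lambda>n. norm (z n)) \<longlonglongrightarrow> 0"
      by (rule tendsto_sandwich[OF _ _ tendsto_const LIMSEQ_inverse_real_of_nat];
          intro always_eventually allI less_imp_le[OF z(3)] norm_ge_zero)
    define u where "u n = (1 / norm (z n)) *\<^sub>R z n" for n
    have "\<forall>n. u n \<in> sphere 0 1"
      using z(2) by (simp add: u_def)
    then obtain l r where l: "l \<in> sphere 0 1" "strict_mono (r :: nat \<Rightarrow> nat)" "(u \<circ> r) \<longlonglongrightarrow> l"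
      using compact_sphere unfolding compact_def by meson
    have "t *\<^sub>R l \<in> S" for t
    proof -
      \<comment> \<open>the largest integer multiple of the length of \<open>z (r n)\<close> that is at most \<open>t\<close>\<close>
      define k where "k n = of_int \<lfloor>t / norm (z (r n))\<rfloor> * norm (z (r n))" for n
      have zr: "(\<lambda>n. norm (z (r n))) \<longlonglongrightarrow> 0"
        using LIMSEQ_subseq_LIMSEQ[OF z_lim l(2)] by (simp add: o_def)
      have "\<bar>k n - t\<bar> \<le> norm (z (r n))" for n
      proof -
        have pos: "norm (z (r n)) > 0" using z(2) by simp
        have lower: "of_int \<lfloor>t / norm (z (r n))\<rfloor> \<le> t / norm (z (r n))"
          and upper: "t / norm (z (r n)) \<le> of_int \<lfloor>t / norm (z (r n))\<rfloor> + 1"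
          by linarith+
        have "k n \<le> t"
          using lower unfolding pos_le_divide_eq[OF pos] k_def .
        moreover have "t \<le> k n + norm (z (r n))"
          using upper unfolding pos_divide_le_eq[OF pos] k_def distrib_right by simp
        ultimately show ?thesis
          by linarith
      qed
      then have "(\<lambda>n. k n - t) \<longlonglongrightarrow> 0"
        by (intro Lim_null_comparison[OF _ zr]) simp
      then have "k \<longlonglongrightarrow> t"
        by (simp add: LIM_zero_iff)
      then have lim: "(\<lambda>n. k n *\<^sub>R (u \<circ> r) n) \<longlonglongrightarrow> t *\<^sub>R l"
        using l(3) by (rule tendsto_scaleR)
      have "k n *\<^sub>R (u \<circ> r) n \<in> S" for n
        using int_mult[OF z(1)] z(2) by (simp add: k_def u_def)
      with \<open>closed S\<close> show ?thesis
        using lim by (rule closed_sequentially)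
    qed
    then have "l \<in> V"
      by (simp add: V_def)
    then have "(u \<circ> r) n \<bullet> l = 0" for n
      using z(4) by (simp add: u_def orthogonal_def)
    then have "l \<bullet> l = 0"
      using tendsto_inner[OF l(3) tendsto_const[of l]] by (simp add: LIMSEQ_const_iff)
    then show False
      using l(1) by simp
  qed
  then obtain \<delta> where \<delta>: "\<delta> > 0" "\<And>s. s \<in> S \<Longrightarrow> norm s < \<delta> \<Longrightarrow> s \<in> V"
    by blast
  have "openin (top_of_set S) V"
    unfolding openin_euclidean_subtopology_iff
  proof (intro conjI ballI VS)
    fix x assume x: "x \<in> V"
    have "y \<in> V" if "y \<in> S" "dist y x < \<delta>" for y
      using subspace_add[OF V x \<delta>(2)[OF S[OF that(1)]], of x] x VS that(2) by (auto simp: dist_norm)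
    then show "\<exists>e>0. \<forall>x'\<in>S. dist x' x < e \<longrightarrow> x' \<in> V"
      using \<delta>(1) by blast
  qed
  moreover have "closedin (top_of_set S) V"
    using V VS by (intro closed_subset closed_subspace)
  ultimately have "V = S"
    using \<open>connected S\<close> V subspace_0 unfolding connected_clopen by blast
  then show ?thesis
    using V by simp
qed

definition torus :: "real^'n^'n \<Rightarrow> real^'n \<Rightarrow> real^'n^'n" where
  "torus P x = P ** diag (\<chi> i. exp (x $ i)) ** matrix_inv P"

lemma diag_one [simp]: "diag (\<chi> i. 1) = mat 1"
  by (simp add: diag_def mat_def vec_eq_iff)

lemma torus_add:
  assumes "invertible P"
  shows "torus P (x + y) = torus P x ** torus P y"
proof -
  have "torus P x ** torus P y
      = P ** diag (\<chi> i. exp (x $ i)) ** (matrix_inv P ** P) ** diag (\<chi> i. exp (y $ i)) ** matrix_inv P"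
    by (simp only: torus_def matrix_mul_assoc)
  also have "\<dots> = P ** (diag (\<chi> i. exp (x $ i)) ** diag (\<chi> i. exp (y $ i))) ** matrix_inv P"
    using assms by (simp add: matrix_mul_assoc)
  also have "\<dots> = torus P (x + y)"
    by (simp add: torus_def diag_mult exp_add)
  finally show ?thesis ..
qed

lemma torus_zero: "invertible P \<Longrightarrow> torus P 0 = mat 1"
  by (simp add: torus_def)

lemma torus_minus: "invertible P \<Longrightarrow> torus P (- x) = matrix_inv (torus P x)"
  by (metis matrix_inv_unique torus_add torus_zero add.right_inverse)

lemma invertible_torus: "invertible P \<Longrightarrow> invertible (torus P x)"
  by (metis invertible_right_inverse torus_add torus_zero add.right_inverse)

lemma continuous_on_torus:
  fixes P :: "real^'n^'n"
  shows "continuous_on S (torus P)"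
proof -
  have "continuous_on S (\<lambda>x. (if i = j then exp (x $ i) else 0))" for i j :: 'n and S :: "(real^'n) set"
    by (cases "i = j") (auto intro!: continuous_intros)
  then show ?thesis
    unfolding torus_def[abs_def] diag_def vec_lambda_beta by (intro continuous_intros)
qed

definition torus_log :: "real^'n^'n \<Rightarrow> real^'n^'n \<Rightarrow> real^'n" where
  "torus_log P a = (\<chi> i. ln ((matrix_inv P ** a ** P) $ i $ i))"

lemma conj_torus:
  assumes "invertible P"
  shows "matrix_inv P ** torus P x ** P = diag (\<chi> i. exp (x $ i))"
proof -
  have "matrix_inv P ** torus P x ** P
      = (matrix_inv P ** P) ** diag (\<chi> i. exp (x $ i)) ** (matrix_inv P ** P)"
    by (simp only: torus_def matrix_mul_assoc)
  then show ?thesis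
    using assms by simp
qed

lemma torus_log_torus [simp]: "invertible P \<Longrightarrow> torus_log P (torus P x) = x"
  by (simp add: torus_log_def conj_torus) (simp add: diag_def vec_eq_iff)

lemma continuous_on_torus_log:
  assumes "invertible P" "S \<subseteq> range (torus P)"
  shows "continuous_on S (torus_log P)"
  unfolding torus_log_def[abs_def]
proof (intro continuous_intros ballI)
  fix a i assume "a \<in> S"
  then obtain x where "a = torus P x"
    using assms(2) by auto
  then show "(matrix_inv P ** a ** P) $ i $ i \<noteq> 0"
    using assms(1) by (simp add: conj_torus) (simp add: diag_def)
qed

lemma closed_vimage_closedin:
  assumes "closedin (top_of_set U) G" "continuous_on UNIV f" "range f \<subseteq> U"
  shows "closed {x. f x \<in> G}"
proof -
  obtain T where "closed T" "G = U \<inter> T"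
    using assms(1) by (auto simp: closedin_closed)
  moreover have "{x. f x \<in> U \<inter> T} = f -` T"
    using assms(3) by auto
  ultimately show ?thesis
    using assms(2) by (simp add: closed_vimage)
qed

text \<open>Diagonalize \<open>A\<close> simultaneously and let \<open>S\<close> be the set of logarithms. It is a connected additive
  group, and maximality of \<open>A\<close> makes it closed: the exponentials of its closure again form a connected
  abelian group of hyperbolic elements, which stays inside \<open>G\<close> because \<open>G\<close> is closed.\<close>

lemma cartan_subspace_torus:
  fixes G A :: "(real^'n^'n) set"
  assumes G: "subgroup G GL" "closedin (top_of_set (carrier GL)) G" and A: "cartan_subspace G A"
  obtains P S where "invertible P" "subspace S" "A = torus P ` S"
proof -
  have A': "subgroup A GL" "A \<subseteq> G" "connected A" "\<And>a b. a \<in> A \<Longrightarrow> b \<in> A \<Longrightarrow> a ** b = b ** a"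
    "\<And>a. a \<in> A \<Longrightarrow> hyperbolic a"
    using A by (auto simp: cartan_subspace_def connected_abelian_hyperbolic_def)
  obtain P :: "real^'n^'n" where P: "invertible P"
    "\<And>a. a \<in> A \<Longrightarrow> \<exists>d. (\<forall>i. d $ i > 0) \<and> a = P ** diag d ** matrix_inv P"
    using simultaneous_diagonalization[of A] A'(4,5) by metis
  have AP: "A \<subseteq> range (torus P)"
  proof
    fix a assume "a \<in> A"
    then obtain d where d: "\<forall>i. d $ i > 0" "a = P ** diag d ** matrix_inv P"
      using P(2) by blast
    have "(\<chi> i. exp ((\<chi> i. ln (d $ i)) $ i)) = d"
      using d(1) by (simp add: vec_eq_iff)
    then have "a = torus P (\<chi> i. ln (d $ i))"
      using d(2) by (simp add: torus_def)
    then show "a \<in> range (torus P)"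
      by blast
  qed
  define S where "S = {x. torus P x \<in> A}"
  have AS: "A = torus P ` S"
    using AP by (auto simp: S_def)
  have "S = torus_log P ` A"
    using P(1) by (force simp: AS)
  then have "connected S"
    using A'(3) continuous_on_torus_log[OF P(1) AP] connected_continuous_image by metis
  have S0: "0 \<in> S"
    using A'(1) P(1) by (simp add: S_def torus_zero subgroup_GL_iff)
  have Sdiff: "x - y \<in> S" if "x \<in> S" "y \<in> S" for x y
  proof -
    have "torus P (x + - y) = torus P x ** matrix_inv (torus P y)"
      using P(1) torus_add torus_minus by metis
    then show ?thesis
      using that A'(1) by (simp add: S_def subgroup_GL_iff)
  qed
  have cl_diff: "x - y \<in> closure S" if "x \<in> closure S" "y \<in> closure S" for x y
  proof -
    have "(\<lambda>(x, y). x - y) ` closure (S \<times> S) \<subseteq> closure S"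
      using Sdiff closure_subset[of S]
      by (intro image_closure_subset) (auto simp: split_def intro!: continuous_intros)
    then show ?thesis
      using that by (auto simp: closure_Times)
  qed
  have cl0: "0 \<in> closure S"
    using S0 closure_subset by blast
  have cl_neg: "- x \<in> closure S" if "x \<in> closure S" for x
    using cl_diff[OF cl0 that] by simp
  have cl_add: "x + y \<in> closure S" if "x \<in> closure S" "y \<in> closure S" for x y
    using cl_diff[OF that(1) cl_neg[OF that(2)]] by simp
  have "connected_abelian_hyperbolic G (torus P ` closure S)"
    unfolding connected_abelian_hyperbolic_def
  proof (intro conjI)
    show "subgroup (torus P ` closure S) GL"
      unfolding subgroup_GL_iff
    proof (intro conjI ballI)
      show "mat 1 \<in> torus P ` closure S"
        using torus_zero[OF P(1)] cl0 by (metis imageI)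
    next
      fix a b assume "a \<in> torus P ` closure S" "b \<in> torus P ` closure S"
      then show "a ** b \<in> torus P ` closure S"
        by (auto simp: torus_add[OF P(1), symmetric] intro!: imageI cl_add)
    next
      fix a assume a: "a \<in> torus P ` closure S"
      then show "matrix_inv a \<in> torus P ` closure S"
        by (auto simp: torus_minus[OF P(1), symmetric] intro!: imageI cl_neg)
      show "invertible a"
        using a invertible_torus[OF P(1)] by blast
    qed
    have "closed {x. torus P x \<in> G}"
      using P(1) by (intro closed_vimage_closedin[OF G(2)] continuous_on_torus) (auto simp: invertible_torus)
    moreover have "S \<subseteq> {x. torus P x \<in> G}"
      using A'(2) by (auto simp: S_def)
    ultimately show "torus P ` closure S \<subseteq> G"
      using closure_minimal by blast
    show "connected (torus P ` closure S)"
      using \<open>connected S\<close> by (intro connected_continuous_image continuous_on_torus connected_imp_connected_closure)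
    show "\<forall>a\<in>torus P ` closure S. \<forall>b\<in>torus P ` closure S. a ** b = b ** a"
      using P(1) by (auto simp flip: torus_add simp: add.commute)
    show "\<forall>a\<in>torus P ` closure S. hyperbolic a"
    proof clarify
      fix x
      show "hyperbolic (torus P x)"
        unfolding hyperbolic_def
        using P(1) by (intro exI[of _ P] exI[of _ "diag (\<chi> i. exp (x $ i))"]) (auto simp: torus_def diag_def)
    qed
  qed
  moreover have "A \<subseteq> torus P ` closure S"
    using AS closure_subset by blast
  ultimately have "torus P ` closure S = A"
    using A unfolding cartan_subspace_def by blast
  then have "closure S \<subseteq> S"
    by (auto simp: S_def)
  then have "closed S"
    using closure_subset_eq by blast
  then have "subspace S"
    using closed_connected_additive_subgroup_imp_subspace \<open>connected S\<close> S0 Sdiff by blast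
  then show thesis
    by (rule that[OF P(1) _ AS])
qed

text \<open>A root is continuous, since it can be read off from a nonzero entry of a root vector.\<close>

lemma closedin_weyl_chamber:
  fixes G A :: "(real^'n^'n) set"
  assumes closed: "closedin (top_of_set U) A" and A: "\<forall>a\<in>A. invertible a"
    and \<Sigma>p: "positive_roots G A \<Sigma>p"
  shows "closedin (top_of_set U) (weyl_chamber A \<Sigma>p)"
proof -
  have "closedin (top_of_set A) {a \<in> A. \<alpha> a \<ge> 1}" if "\<alpha> \<in> \<Sigma>p" for \<alpha>
  proof -
    have "\<alpha> \<in> restricted_roots G A"
      using \<Sigma>p that by (auto simp: positive_roots_def)
    then obtain X where X: "X \<noteq> 0" "\<And>a. a \<in> A \<Longrightarrow> a ** X ** matrix_inv a = \<alpha> a *\<^sub>R X"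
      by (auto simp: restricted_roots_def)
    then obtain i j where ij: "X $ i $ j \<noteq> 0"
      by (auto simp: vec_eq_iff)
    have "\<alpha> a = (a ** X ** matrix_inv a) $ i $ j / X $ i $ j" if "a \<in> A" for a
      using ij that by (simp add: X(2))
    moreover have "continuous_on A (\<lambda>a. (a ** X ** matrix_inv a) $ i $ j / X $ i $ j)"
      using A ij by (intro continuous_intros) auto
    ultimately have "continuous_on A \<alpha>"
      by (simp cong: continuous_on_cong)
    then have "closedin (top_of_set A) (A \<inter> \<alpha> -` {1..})"
      by (intro continuous_closedin_preimage) auto
    then show ?thesis
      by (simp add: vimage_def Int_def)
  qed
  then have "closedin (top_of_set A) (\<Inter>\<alpha>\<in>insert (\<lambda>_. 1) \<Sigma>p. {a \<in> A. \<alpha> a \<ge> 1})"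
    by (intro closedin_Inter) auto
  moreover have "(\<Inter>\<alpha>\<in>insert (\<lambda>_. 1) \<Sigma>p. {a \<in> A. \<alpha> a \<ge> 1}) = weyl_chamber A \<Sigma>p"
    by (auto simp: weyl_chamber_def)
  ultimately show ?thesis
    using closedin_trans[OF _ closed] by simp
qed

text \<open>In the basis given by \<open>P\<close>, an invertible limit of diagonal matrices with positive entries is again
  of this kind, so the range of the torus is closed; on it the logarithm is continuous.\<close>

lemma closedin_torus_image:
  fixes P :: "real^'n^'n"
  assumes P: "invertible P" and "closed S"
  shows "closedin (top_of_set (carrier GL)) (torus P ` S)"
proof -
  define T where "T = {a. (\<forall>i j. (if i = j then 0 else (matrix_inv P ** a ** P) $ i $ j) = 0) \<and>
      (\<forall>i. 0 \<le> (matrix_inv P ** a ** P) $ i $ i)}"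
  have "continuous_on UNIV (\<lambda>a. if i = j then 0 else (matrix_inv P ** a ** P) $ i $ j)" for i j
    by (cases "i = j") (auto intro!: continuous_intros)
  then have "closed T"
    unfolding T_def
    by (intro closed_Collect_all closed_Collect_conj closed_Collect_eq closed_Collect_le continuous_intros)
  have "range (torus P) = carrier GL \<inter> T"
  proof (intro equalityI subsetI)
    fix a assume "a \<in> range (torus P)"
    then show "a \<in> carrier GL \<inter> T"
      using P by (auto simp: T_def conj_torus invertible_torus diag_def)
  next
    fix a assume a: "a \<in> carrier GL \<inter> T"
    define d where "d = (\<chi> i. (matrix_inv P ** a ** P) $ i $ i)"
    have D: "matrix_inv P ** a ** P = diag d"
      using a by (simp add: T_def vec_eq_iff diag_def d_def) metis
    have "diag d ** (matrix_inv P ** (matrix_inv a ** P)) = matrix_inv P ** (a ** (P ** matrix_inv P) ** matrix_inv a) ** P"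
      by (simp only: D[symmetric] matrix_mul_assoc)
    also have "\<dots> = mat 1"
      using a P by simp
    finally have "d $ i * (matrix_inv P ** (matrix_inv a ** P)) $ i $ i = 1" for i
      using diag_nth(1)[of d "matrix_inv P ** (matrix_inv a ** P)" i i] by (simp add: mat_def)
    moreover have "d $ i \<ge> 0" for i
      using a by (simp add: T_def d_def)
    ultimately have "d $ i > 0" for i
      by (metis less_eq_real_def mult_zero_left zero_neq_one)
    then have "(\<chi> i. exp ((\<chi> i. ln (d $ i)) $ i)) = d"
      by (simp add: vec_eq_iff)
    then have "torus P (\<chi> i. ln (d $ i)) = P ** (matrix_inv P ** a ** P) ** matrix_inv P"
      by (simp only: torus_def D)
    also have "\<dots> = (P ** matrix_inv P) ** a ** (P ** matrix_inv P)"
      by (simp only: matrix_mul_assoc)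
    also have "\<dots> = a"
      using P by simp
    finally show "a \<in> range (torus P)"
      by (rule range_eqI[OF sym])
  qed
  then have "closedin (top_of_set (carrier GL)) (range (torus P))"
    using \<open>closed T\<close> by (simp add: closedin_closed_Int)
  moreover have "closedin (top_of_set (range (torus P))) (range (torus P) \<inter> torus_log P -` S)"
    using P assms(2) by (intro continuous_closedin_preimage continuous_on_torus_log) auto
  moreover have "range (torus P) \<inter> torus_log P -` S = torus P ` S"
    using P by auto
  ultimately show ?thesis
    using closedin_trans by metis
qed

section \<open>Proper actions on coset spaces\<close>

lemma l_coset_GL: "g <#\<^bsub>GL\<^esub> H = (\<lambda>h. g ** h) ` H"
  by (auto simp: l_coset_def)

lemma l_coset_GL_assoc: "h <#\<^bsub>GL\<^esub> (g <#\<^bsub>GL\<^esub> H) = (h ** g) <#\<^bsub>GL\<^esub> H"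
  by (simp add: l_coset_GL image_image matrix_mul_assoc)

lemma l_coset_GL_eq_iff:
  fixes H :: "(real^'n^'n) set"
  assumes H: "subgroup H GL" and g: "invertible g"
  shows "g <#\<^bsub>GL\<^esub> H = g' <#\<^bsub>GL\<^esub> H \<longleftrightarrow> (\<exists>h\<in>H. g' = g ** h)"
proof
  assume eq: "g <#\<^bsub>GL\<^esub> H = g' <#\<^bsub>GL\<^esub> H"
  have "g' ** mat 1 \<in> g' <#\<^bsub>GL\<^esub> H"
    using H unfolding l_coset_GL subgroup_GL_iff by blast
  then show "\<exists>h\<in>H. g' = g ** h"
    unfolding eq[symmetric] by (auto simp: l_coset_GL)
next
  assume "\<exists>h\<in>H. g' = g ** h"
  then obtain h where h: "h \<in> H" "g' = g ** h"
    by blast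
  have "(\<lambda>k. h ** k) ` H = H"
  proof (intro equalityI subsetI)
    fix k assume "k \<in> H"
    then have "matrix_inv h ** k \<in> H" "k = h ** (matrix_inv h ** k)"
      using H h(1) by (auto simp: subgroup_GL_iff matrix_mul_assoc)
    then show "k \<in> (\<lambda>k. h ** k) ` H"
      by blast
  qed (use H h(1) in \<open>auto simp: subgroup_GL_iff\<close>)
  moreover have "g' <#\<^bsub>GL\<^esub> H = (\<lambda>k. g ** k) ` (\<lambda>k. h ** k) ` H"
    by (auto simp: l_coset_GL h(2) matrix_mul_assoc image_image)
  ultimately show "g <#\<^bsub>GL\<^esub> H = g' <#\<^bsub>GL\<^esub> H"
    by (simp add: l_coset_GL)
qed

lemma translates_meeting_eq:
  fixes G H L :: "(real^'n^'n) set"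
  assumes G: "subgroup G GL" and H: "subgroup H GL" and L: "L \<subseteq> G" and "F \<subseteq> G"
  shows "{h \<in> F. (\<lambda>c. h <#\<^bsub>GL\<^esub> c) ` (\<lambda>g. g <#\<^bsub>GL\<^esub> H) ` L \<inter> (\<lambda>g. g <#\<^bsub>GL\<^esub> H) ` L \<noteq> {}}
    = F \<inter> (L <#>\<^bsub>GL\<^esub> H <#>\<^bsub>GL\<^esub> matrix_inv ` L)"
proof -
  have inv: "invertible x" if "x \<in> G" for x
    using that G by (auto simp: subgroup_GL_iff)
  have "(\<lambda>c. h <#\<^bsub>GL\<^esub> c) ` (\<lambda>g. g <#\<^bsub>GL\<^esub> H) ` L \<inter> (\<lambda>g. g <#\<^bsub>GL\<^esub> H) ` L \<noteq> {} \<longleftrightarrow>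
      h \<in> L <#>\<^bsub>GL\<^esub> H <#>\<^bsub>GL\<^esub> matrix_inv ` L" if "h \<in> F" for h
  proof -
    have "(\<lambda>c. h <#\<^bsub>GL\<^esub> c) ` (\<lambda>g. g <#\<^bsub>GL\<^esub> H) ` L \<inter> (\<lambda>g. g <#\<^bsub>GL\<^esub> H) ` L \<noteq> {} \<longleftrightarrow>
        (\<exists>l\<in>L. \<exists>l'\<in>L. l' <#\<^bsub>GL\<^esub> H = (h ** l) <#\<^bsub>GL\<^esub> H)"
      unfolding image_image l_coset_GL_assoc by blast
    also have "\<dots> \<longleftrightarrow> (\<exists>l\<in>L. \<exists>l'\<in>L. \<exists>k\<in>H. h ** l = l' ** k)"
      using l_coset_GL_eq_iff[OF H] inv L by (meson subsetD)
    also have "\<dots> \<longleftrightarrow> (\<exists>l\<in>L. \<exists>l'\<in>L. \<exists>k\<in>H. h = l' ** k ** matrix_inv l)"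
    proof -
      have "h ** l = l' ** k \<longleftrightarrow> h = l' ** k ** matrix_inv l" if "l \<in> L" for l l' k
      proof -
        have "h ** l ** matrix_inv l = h" "l' ** k ** matrix_inv l ** l = l' ** k"
          using inv[of l] that L by (auto simp flip: matrix_mul_assoc)
        then show ?thesis
          by metis
      qed
      then show ?thesis
        by blast
    qed
    also have "\<dots> \<longleftrightarrow> h \<in> L <#>\<^bsub>GL\<^esub> H <#>\<^bsub>GL\<^esub> matrix_inv ` L"
      unfolding mem_set_mult3_GL by blast
    finally show ?thesis .
  qed
  then show ?thesis
    by blast
qed

lemma topspace_coset_topology: "topspace (coset_topology G H) = (\<lambda>g. g <#\<^bsub>GL\<^esub> H) ` G"
  using quotient_imp_surjective_map[OF quotient_map_coset_topology[of G H]]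
  unfolding topspace_euclidean_subtopology by (rule sym)

text \<open>The preimage of the image of \<open>U\<close> is the union of the translates of \<open>U\<close> by elements of \<open>H\<close>.\<close>

lemma open_map_coset_projection:
  fixes G H :: "(real^'n^'n) set"
  assumes G: "subgroup G GL" and H: "subgroup H GL" "H \<subseteq> G" and U: "openin (top_of_set G) U"
  shows "openin (coset_topology G H) ((\<lambda>g. g <#\<^bsub>GL\<^esub> H) ` U)"
  unfolding openin_coset_topology
proof
  have UG: "U \<subseteq> G"
    using U openin_imp_subset by blast
  then show "(\<lambda>g. g <#\<^bsub>GL\<^esub> H) ` U \<subseteq> coset_space G H"
    by (auto simp: coset_space_def)
  have "g <#\<^bsub>GL\<^esub> H \<in> (\<lambda>g. g <#\<^bsub>GL\<^esub> H) ` U \<longleftrightarrow> (\<exists>h\<in>H. g ** h \<in> U)" if "g \<in> G" for g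
  proof -
    have "invertible g"
      using that G by (auto simp: subgroup_GL_iff)
    then show ?thesis
      using l_coset_GL_eq_iff[OF H(1), of g] by (metis (no_types, lifting) image_iff)
  qed
  then have "{g \<in> G. g <#\<^bsub>GL\<^esub> H \<in> (\<lambda>g. g <#\<^bsub>GL\<^esub> H) ` U} = {g \<in> G. \<exists>h\<in>H. g ** h \<in> U}"
    by (intro Collect_cong conj_cong refl)
  also have "\<dots> = (\<Union>h\<in>H. G \<inter> (\<lambda>g. g ** h) -` U)"
    by blast
  finally have "{g \<in> G. g <#\<^bsub>GL\<^esub> H \<in> (\<lambda>g. g <#\<^bsub>GL\<^esub> H) ` U} = (\<Union>h\<in>H. G \<inter> (\<lambda>g. g ** h) -` U)" .
  moreover have "openin (top_of_set G) (G \<inter> (\<lambda>g. g ** h) -` U)" if "h \<in> H" for h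
    using G H that by (intro continuous_openin_preimage[OF _ _ U] continuous_intros)
      (auto simp: subgroup_GL_iff)
  ultimately show "openin (top_of_set G) {g \<in> G. g <#\<^bsub>GL\<^esub> H \<in> (\<lambda>g. g <#\<^bsub>GL\<^esub> H) ` U}"
    by (simp only:) (rule openin_Union, auto)
qed

text \<open>For distinct cosets of \<open>g\<close> and \<open>g'\<close> the element \<open>g\<^sup>-\<^sup>1 g'\<close> lies in the complement of \<open>H\<close>, which
  is open in \<open>G\<close>; hence so does \<open>x\<^sup>-\<^sup>1 y\<close> for all \<open>x\<close> near \<open>g\<close> and \<open>y\<close> near \<open>g'\<close>,
  whose cosets are therefore distinct.\<close>

lemma Hausdorff_coset_topology:
  fixes G H :: "(real^'n^'n) set"
  assumes G: "subgroup G GL" and H: "closed_subgroup H G"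
  shows "Hausdorff_space (coset_topology G H)"
  unfolding Hausdorff_space_def
proof (intro allI impI, elim conjE)
  fix c c' assume "c \<in> topspace (coset_topology G H)" "c' \<in> topspace (coset_topology G H)" "c \<noteq> c'"
  then obtain g g' where g: "g \<in> G" "g' \<in> G" "c = g <#\<^bsub>GL\<^esub> H" "c' = g' <#\<^bsub>GL\<^esub> H"
    and ne: "g <#\<^bsub>GL\<^esub> H \<noteq> g' <#\<^bsub>GL\<^esub> H"
    by (auto simp: topspace_coset_topology)
  have H': "subgroup H GL" "H \<subseteq> G" "closedin (top_of_set G) H"
    using H by (auto simp: closed_subgroup_def)
  have Ginv: "invertible x" "matrix_inv x \<in> G" if "x \<in> G" for x
    using that G by (auto simp: subgroup_GL_iff)
  have coset_eq: "x <#\<^bsub>GL\<^esub> H = y <#\<^bsub>GL\<^esub> H \<longleftrightarrow> matrix_inv x ** y \<in> H" if "x \<in> G" for x y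
  proof -
    have "matrix_inv x ** (x ** h) = h" "y = x ** (matrix_inv x ** y)" for h
      using Ginv(1)[OF that] by (simp_all add: matrix_mul_assoc)
    then have "(\<exists>h\<in>H. y = x ** h) \<longleftrightarrow> matrix_inv x ** y \<in> H"
      by metis
    then show ?thesis
      using l_coset_GL_eq_iff[OF H'(1) Ginv(1)[OF that], of y] by simp
  qed
  define W where "W = (G \<times> G) \<inter> (\<lambda>(x, y). matrix_inv x ** y) -` (G - H)"
  have "openin (top_of_set (G \<times> G)) W"
    unfolding W_def split_def
  proof (rule continuous_openin_preimage)
    show "openin (top_of_set G) (G - H)"
      using H'(3) by (simp add: openin_diff)
    show "continuous_on (G \<times> G) (\<lambda>z. matrix_inv (fst z) ** snd z)"
      using Ginv(1) by (intro continuous_intros) auto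
  qed (use G in \<open>auto simp: subgroup_GL_iff\<close>)
  then obtain T where T: "open T" "W = (G \<times> G) \<inter> T"
    by (auto simp: openin_open)
  have "(g, g') \<in> W"
    using g ne coset_eq[OF g(1)] G by (auto simp: W_def subgroup_GL_iff)
  then obtain A B where AB: "open A" "open B" "(g, g') \<in> A \<times> B" "A \<times> B \<subseteq> T"
    using T by (metis IntD2 open_prod_elim)
  define U V where "U = G \<inter> A" and "V = G \<inter> B"
  have "openin (top_of_set G) U" "openin (top_of_set G) V"
    using AB by (auto simp: U_def V_def openin_open)
  then have "openin (coset_topology G H) ((\<lambda>g. g <#\<^bsub>GL\<^esub> H) ` U)"
    "openin (coset_topology G H) ((\<lambda>g. g <#\<^bsub>GL\<^esub> H) ` V)"
    using open_map_coset_projection[OF G H'(1,2)] by blast+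
  moreover have "c \<in> (\<lambda>g. g <#\<^bsub>GL\<^esub> H) ` U" "c' \<in> (\<lambda>g. g <#\<^bsub>GL\<^esub> H) ` V"
    using g AB by (auto simp: U_def V_def)
  moreover have "disjnt ((\<lambda>g. g <#\<^bsub>GL\<^esub> H) ` U) ((\<lambda>g. g <#\<^bsub>GL\<^esub> H) ` V)"
  proof -
    have "x <#\<^bsub>GL\<^esub> H \<noteq> y <#\<^bsub>GL\<^esub> H" if "x \<in> U" "y \<in> V" for x y
    proof -
      have "(x, y) \<in> W"
        using that T AB by (auto simp: U_def V_def)
      then show ?thesis
        using coset_eq[of x y] by (auto simp: W_def)
    qed
    then show ?thesis
      by (auto simp: disjnt_iff)
  qed
  ultimately show "\<exists>U V. openin (coset_topology G H) U \<and> openin (coset_topology G H) V \<and>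
      c \<in> U \<and> c' \<in> V \<and> disjnt U V"
    by (intro exI[of _ "(\<lambda>g. g <#\<^bsub>GL\<^esub> H) ` U"] exI[of _ "(\<lambda>g. g <#\<^bsub>GL\<^esub> H) ` V"] conjI)
qed

lemma locally_compact_closed_in_GL:
  fixes G :: "(real^'n^'n) set"
  assumes G: "closedin (top_of_set (carrier GL)) G" and g: "g \<in> G"
  obtains U V where "openin (top_of_set G) U" "g \<in> U" "U \<subseteq> V" "compact V" "V \<subseteq> G"
proof -
  have "open (carrier GL :: (real^'n^'n) set)"
  proof -
    have "carrier GL = (\<lambda>x :: real^'n^'n. det x) -` (- {0})"
      by (auto simp: GL_def invertible_det_nz)
    moreover have "open ((\<lambda>x :: real^'n^'n. det x) -` (- {0}))"
      by (intro open_vimage continuous_intros)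
    ultimately show ?thesis
      by simp
  qed
  moreover have "g \<in> carrier GL"
    using G g closedin_imp_subset by blast
  ultimately obtain e where e: "e > 0" "cball g e \<subseteq> carrier GL"
    by (meson open_contains_cball)
  show thesis
  proof
    show "openin (top_of_set G) (G \<inter> ball g e)"
      by (simp add: openin_open_Int)
    show "compact (cball g e \<inter> G)"
      using e by (intro compact_Int_closedin[OF G]) auto
  qed (use e g in auto)
qed

text \<open>The images of relatively compact open sets cover \<open>c\<close>, and finitely many of them suffice; this gives
  a compact set with image containing \<open>c\<close>. Intersecting it with the preimage of \<open>c\<close> preserves
  compactness because \<open>c\<close> is closed.\<close>

lemma compact_lift_coset_topology:
  fixes G H :: "(real^'n^'n) set"
  assumes G: "subgroup G GL" "closedin (top_of_set (carrier GL)) G" and H: "closed_subgroup H G"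
    and c: "compactin (coset_topology G H) c"
  obtains L where "compact L" "L \<subseteq> G" "c = (\<lambda>g. g <#\<^bsub>GL\<^esub> H) ` L"
proof -
  let ?\<pi> = "\<lambda>g. g <#\<^bsub>GL\<^esub> H"
  have H': "subgroup H GL" "H \<subseteq> G"
    using H by (auto simp: closed_subgroup_def)
  have "\<exists>U V. openin (top_of_set G) U \<and> g \<in> U \<and> U \<subseteq> V \<and> compact V \<and> V \<subseteq> G" if "g \<in> G" for g
    using locally_compact_closed_in_GL[OF G(2) that] by metis
  then obtain U V where UV: "\<And>g. g \<in> G \<Longrightarrow> openin (top_of_set G) (U g)" "\<And>g. g \<in> G \<Longrightarrow> g \<in> U g"
    "\<And>g. g \<in> G \<Longrightarrow> U g \<subseteq> V g" "\<And>g. g \<in> G \<Longrightarrow> compact (V g)" "\<And>g. g \<in> G \<Longrightarrow> V g \<subseteq> G"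
    by metis
  have cover: "c \<subseteq> \<Union> ((\<lambda>g. ?\<pi> ` U g) ` G)"
    using compactin_subset_topspace[OF c] UV(2) unfolding topspace_coset_topology by blast
  have "openin (coset_topology G H) W" if "W \<in> (\<lambda>g. ?\<pi> ` U g) ` G" for W
    using that open_map_coset_projection[OF G(1) H'] UV(1) by auto
  from compactinD[OF c this cover]
  obtain \<F> where \<F>: "finite \<F>" "\<F> \<subseteq> (\<lambda>g. ?\<pi> ` U g) ` G" "c \<subseteq> \<Union> \<F>"
    by blast
  obtain F where "F \<subseteq> G" "finite F" "\<F> = (\<lambda>g. ?\<pi> ` U g) ` F"
    using finite_subset_image[OF \<F>(1,2)] by blast
  with \<F>(3) have F: "finite F" "F \<subseteq> G" "c \<subseteq> \<Union> ((\<lambda>g. ?\<pi> ` U g) ` F)"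
    by simp_all
  define Z where "Z = (\<Union>g\<in>F. V g)"
  have "compact Z"
    using F(2) UV(4) unfolding Z_def by (intro compact_UN[OF F(1)]) auto
  moreover have "Z \<subseteq> G"
    using F(2) UV(5) unfolding Z_def by blast
  ultimately have Z: "compact Z" "Z \<subseteq> G"
    by auto
  have "closedin (coset_topology G H) c"
    using c Hausdorff_coset_topology[OF G(1) H] compactin_imp_closedin by blast
  then have "closedin (top_of_set G) {g \<in> topspace (top_of_set G). ?\<pi> g \<in> c}"
    using quotient_imp_continuous_map[OF quotient_map_coset_topology] closedin_continuous_map_preimage by blast
  then have "compact (Z \<inter> {g \<in> G. ?\<pi> g \<in> c})"
    unfolding topspace_euclidean_subtopology using Z by (rule compact_Int_closedin)
  moreover have "c = ?\<pi> ` (Z \<inter> {g \<in> G. ?\<pi> g \<in> c})"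
  proof -
    have "x \<in> ?\<pi> ` (Z \<inter> {g \<in> G. ?\<pi> g \<in> c})" if x: "x \<in> c" for x
    proof -
      obtain f g where "f \<in> F" "g \<in> U f" "x = ?\<pi> g"
        using F(3) x by blast
      then show ?thesis
        using x F(2) UV(3,5) unfolding Z_def by blast
    qed
    then show ?thesis
      by blast
  qed
  ultimately show thesis
    using that[of "Z \<inter> {g \<in> G. ?\<pi> g \<in> c}"] by blast
qed

text \<open>The compact sets of cosets are exactly the images of the compact subsets of \<open>G\<close>.\<close>

lemma acts_properly_iff:
  fixes G H1 H2 :: "(real^'n^'n) set"
  assumes G: "subgroup G GL" "closedin (top_of_set (carrier GL)) G"
    and H1: "H1 \<subseteq> G" and H2: "closed_subgroup H2 G"
  shows "acts_properly G H1 H2 \<longleftrightarrow>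
    (\<forall>L. compact L \<and> L \<subseteq> G \<longrightarrow> compact (H1 \<inter> (L <#>\<^bsub>GL\<^esub> H2 <#>\<^bsub>GL\<^esub> matrix_inv ` L)))"
proof -
  have H2': "subgroup H2 GL"
    using H2 by (simp add: closed_subgroup_def)
  have "compactin (coset_topology G H2) c \<longleftrightarrow>
      (\<exists>L. compact L \<and> L \<subseteq> G \<and> c = (\<lambda>g. g <#\<^bsub>GL\<^esub> H2) ` L)" for c
  proof
    assume "\<exists>L. compact L \<and> L \<subseteq> G \<and> c = (\<lambda>g. g <#\<^bsub>GL\<^esub> H2) ` L"
    then obtain L where L: "compact L" "L \<subseteq> G" "c = (\<lambda>g. g <#\<^bsub>GL\<^esub> H2) ` L"
      by blast
    then have "compactin (top_of_set G) L"
      by (simp add: compactin_subtopology)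
    then show "compactin (coset_topology G H2) c"
      unfolding L(3) using quotient_imp_continuous_map[OF quotient_map_coset_topology]
      by (rule image_compactin)
  next
    assume "compactin (coset_topology G H2) c"
    then show "\<exists>L. compact L \<and> L \<subseteq> G \<and> c = (\<lambda>g. g <#\<^bsub>GL\<^esub> H2) ` L"
      using compact_lift_coset_topology[OF G H2] by metis
  qed
  then have "acts_properly G H1 H2 \<longleftrightarrow> (\<forall>c. (\<exists>L. compact L \<and> L \<subseteq> G \<and> c = (\<lambda>g. g <#\<^bsub>GL\<^esub> H2) ` L) \<longrightarrow>
      compact {h \<in> H1. (\<lambda>c. h <#\<^bsub>GL\<^esub> c) ` c \<inter> c \<noteq> {}})"
    unfolding acts_properly_def by simp
  also have "\<dots> \<longleftrightarrow> (\<forall>L. compact L \<and> L \<subseteq> G \<longrightarrow>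
      compact {h \<in> H1. (\<lambda>c. h <#\<^bsub>GL\<^esub> c) ` (\<lambda>g. g <#\<^bsub>GL\<^esub> H2) ` L \<inter> (\<lambda>g. g <#\<^bsub>GL\<^esub> H2) ` L \<noteq> {}})"
    by blast
  also have "\<dots> \<longleftrightarrow>
      (\<forall>L. compact L \<and> L \<subseteq> G \<longrightarrow> compact (H1 \<inter> (L <#>\<^bsub>GL\<^esub> H2 <#>\<^bsub>GL\<^esub> matrix_inv ` L)))"
    using translates_meeting_eq[OF G(1) H2' _ H1]
    by (intro all_cong1 imp_cong refl arg_cong[of _ _ compact]) simp
  finally show ?thesis .
qed

section \<open>The Cartan projection under bounded perturbations\<close>

text \<open>\<open>diagonal_entry_near_some_entry\<close> in logarithmic coordinates, with a constant that is uniform over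
  multipliers from a compact set.\<close>

lemma torus_entries_near:
  fixes P :: "real^'n^'n"
  assumes P: "invertible P" and N: "compact N" "N \<subseteq> carrier GL"
  obtains r where "r \<ge> 0"
    "\<And>u w x x' i. u \<in> N \<Longrightarrow> w \<in> N \<Longrightarrow> u ** torus P x' = torus P x ** w \<Longrightarrow> \<exists>j. \<bar>x' $ i - x $ j\<bar> \<le> r"
proof -
  define N' where "N' = (\<lambda>n. matrix_inv P ** n ** P) ` (N \<union> matrix_inv ` N)"
  have "compact (N \<union> matrix_inv ` N)"
    using N by (simp add: compact_Un compact_inv)
  then have "compact N'"
    unfolding N'_def by (intro compact_continuous_image continuous_intros)
  then obtain c where c: "c \<ge> 1" "\<And>n v. n \<in> N' \<Longrightarrow> norm (n *v v) \<le> c * norm v"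
    using compact_matrices_bound by blast
  have bounds: "norm ((matrix_inv P ** n ** P) *v v) \<le> c * norm v"
    "norm v \<le> c * norm ((matrix_inv P ** n ** P) *v v)" if "n \<in> N" for n v
  proof -
    show "norm ((matrix_inv P ** n ** P) *v v) \<le> c * norm v"
      using that c(2) by (simp add: N'_def)
    have "invertible n"
      using that N(2) by auto
    have "(matrix_inv P ** matrix_inv n ** P) ** (matrix_inv P ** n ** P)
        = matrix_inv P ** (matrix_inv n ** (P ** matrix_inv P) ** n) ** P"
      by (simp only: matrix_mul_assoc)
    also have "\<dots> = mat 1"
      using P \<open>invertible n\<close> by simp
    finally have "(matrix_inv P ** matrix_inv n ** P) *v ((matrix_inv P ** n ** P) *v v) = v"
      by (simp add: matrix_vector_mul_assoc)
    moreover have "matrix_inv P ** matrix_inv n ** P \<in> N'"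
      using that by (simp add: N'_def)
    ultimately show "norm v \<le> c * norm ((matrix_inv P ** n ** P) *v v)"
      using c(2) by metis
  qed
  show thesis
  proof
    show "2 * ln c \<ge> 0"
      using c(1) by simp
    fix u w x x' and i :: 'n
    assume uw: "u \<in> N" "w \<in> N" and eq: "u ** torus P x' = torus P x ** w"
    have "(matrix_inv P ** u ** P) ** diag (\<chi> i. exp (x' $ i)) = diag (\<chi> i. exp (x $ i)) ** (matrix_inv P ** w ** P)"
    proof -
      have "(matrix_inv P ** u ** P) ** diag (\<chi> i. exp (x' $ i))
          = matrix_inv P ** (u ** (P ** matrix_inv P) ** torus P x') ** P"
        by (simp only: conj_torus[OF P, symmetric] matrix_mul_assoc)
      also have "\<dots> = matrix_inv P ** (torus P x ** (P ** matrix_inv P) ** w) ** P"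
        using P eq by simp
      also have "\<dots> = diag (\<chi> i. exp (x $ i)) ** (matrix_inv P ** w ** P)"
        by (simp only: conj_torus[OF P, symmetric] matrix_mul_assoc)
      finally show ?thesis .
    qed
    from diagonal_entry_near_some_entry[OF this _ _ bounds(2)[OF uw(1)] bounds(1)[OF uw(1)]
        bounds(2)[OF uw(2)] bounds(1)[OF uw(2)] c(1), of i]
    show "\<exists>j. \<bar>x' $ i - x $ j\<bar> \<le> 2 * ln c"
      by auto
  qed
qed

text \<open>\<open>C\<close> stands for the Weyl chamber, as a closed set of representatives of the double cosets of \<open>K\<close>.\<close>

locale group_with_cartan_projection =
  fixes G K C :: "(real^'n^'n) set" and \<mu> :: "real^'n^'n \<Rightarrow> real^'n^'n"
  assumes G: "subgroup G GL" "closedin (top_of_set (carrier GL)) G"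
    and K: "subgroup K GL" "K \<subseteq> G" "compact K"
    and C: "C \<subseteq> G" "closedin (top_of_set (carrier GL)) C"
    and proj: "cartan_projection G K C \<mu>"
begin

lemma G_mult: "x \<in> G \<Longrightarrow> y \<in> G \<Longrightarrow> x ** y \<in> G" and G_inv: "x \<in> G \<Longrightarrow> matrix_inv x \<in> G"
  and G_invertible: "x \<in> G \<Longrightarrow> invertible x" and G_GL: "G \<subseteq> carrier GL"
  using G(1) by (auto simp: subgroup_GL_iff)

lemma K_mult: "x \<in> K \<Longrightarrow> y \<in> K \<Longrightarrow> x ** y \<in> K" and K_inv: "x \<in> K \<Longrightarrow> matrix_inv x \<in> K"
  and K_one: "mat 1 \<in> K" and K_invertible: "x \<in> K \<Longrightarrow> invertible x" and K_in_G: "x \<in> K \<Longrightarrow> x \<in> G"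
  using K(1,2) by (auto simp: subgroup_GL_iff)

lemma set_mult_in_G: "X \<subseteq> G \<Longrightarrow> Y \<subseteq> G \<Longrightarrow> X <#>\<^bsub>GL\<^esub> Y \<subseteq> G"
  by (auto simp: mem_set_mult_GL subset_iff intro: G_mult)

lemma mu_in_C: "g \<in> G \<Longrightarrow> \<mu> g \<in> C"
  and mu_cases: "g \<in> G \<Longrightarrow> \<exists>k\<in>K. \<exists>k'\<in>K. \<mu> g = k ** g ** k'"
  and mu_eqI: "g \<in> G \<Longrightarrow> k \<in> K \<Longrightarrow> k' \<in> K \<Longrightarrow> k ** g ** k' \<in> C \<Longrightarrow> \<mu> g = k ** g ** k'"
proof -
  assume g: "g \<in> G"
  then have eq: "(K <#>\<^bsub>GL\<^esub> {g} <#>\<^bsub>GL\<^esub> K) \<inter> C = {\<mu> g}"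
    using proj by (simp add: cartan_projection_def)
  then show "\<mu> g \<in> C"
    by blast
  have "\<mu> g \<in> K <#>\<^bsub>GL\<^esub> {g} <#>\<^bsub>GL\<^esub> K"
    using eq by blast
  then show "\<exists>k\<in>K. \<exists>k'\<in>K. \<mu> g = k ** g ** k'"
    unfolding mem_set_mult3_GL by blast
  assume "k \<in> K" "k' \<in> K" "k ** g ** k' \<in> C"
  then have "k ** g ** k' \<in> (K <#>\<^bsub>GL\<^esub> {g} <#>\<^bsub>GL\<^esub> K) \<inter> C"
    unfolding Int_iff mem_set_mult3_GL by blast
  then show "\<mu> g = k ** g ** k'"
    using eq by simp
qed

lemma mu_in_G: "g \<in> G \<Longrightarrow> \<mu> g \<in> G"
  using mu_in_C C(1) by blast

lemma mu_biinvariant: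
  assumes "g \<in> G" "k \<in> K" "k' \<in> K"
  shows "\<mu> (k ** g ** k') = \<mu> g"
proof -
  have kg: "k ** g ** k' \<in> G"
    using assms by (simp add: G_mult K_in_G)
  obtain p q where pq: "p \<in> K" "q \<in> K" "\<mu> (k ** g ** k') = p ** (k ** g ** k') ** q"
    using mu_cases[OF kg] by blast
  then have eq: "\<mu> (k ** g ** k') = (p ** k) ** g ** (k' ** q)"
    by (simp add: matrix_mul_assoc)
  have "\<mu> g = (p ** k) ** g ** (k' ** q)"
    using assms pq mu_in_C[OF kg] by (intro mu_eqI K_mult) (simp_all add: eq)
  then show ?thesis
    using eq by simp
qed

lemma mu_decomposition:
  assumes "g \<in> G"
  obtains k k' where "k \<in> K" "k' \<in> K" "g = k ** \<mu> g ** k'"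
proof -
  obtain p q where pq: "p \<in> K" "q \<in> K" "\<mu> g = p ** g ** q"
    using mu_cases[OF assms] by blast
  have "matrix_inv p ** \<mu> g ** matrix_inv q = (matrix_inv p ** p) ** g ** (q ** matrix_inv q)"
    by (simp only: pq(3) matrix_mul_assoc)
  also have "\<dots> = g"
    using pq(1,2) by (simp add: K_invertible)
  finally show thesis
    using that[of "matrix_inv p" "matrix_inv q"] pq K_inv by simp
qed

text \<open>Over a compact set the graph of \<open>\<mu>\<close> is closed: by uniqueness of the projection it consists of the
  pairs \<open>(g, k g k')\<close> with \<open>k\<close>, \<open>k'\<close> in the compact group \<open>K\<close> and \<open>k g k'\<close> in the closed set \<open>C\<close>.\<close>

lemma continuous_on_mu:
  assumes L: "compact L" "L \<subseteq> G"
  shows "continuous_on L \<mu>"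
proof (rule continuous_from_closed_graph)
  define T where "T = (K <#>\<^bsub>GL\<^esub> L <#>\<^bsub>GL\<^esub> K) \<inter> C"
  have "K <#>\<^bsub>GL\<^esub> L <#>\<^bsub>GL\<^esub> K \<subseteq> carrier GL"
    using L(2) K(2) G_GL set_mult_in_G by (meson order_trans)
  then show T: "compact T"
    unfolding T_def using L K(3) by (intro compact_Int_closedin[OF C(2)] compact_mult)
  show "\<mu> \<in> L \<rightarrow> T"
  proof
    fix g assume "g \<in> L"
    then show "\<mu> g \<in> T"
      using L(2) mu_in_C mu_cases unfolding T_def Int_iff mem_set_mult3_GL by blast
  qed
  define I where "I = (\<lambda>(k, g, k'). (g, k ** g ** k')) ` (K \<times> L \<times> K)"
  have "compact I"
    unfolding I_def split_def using L(1) K(3)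
    by (intro compact_continuous_image compact_Times continuous_intros)
  moreover have "(\<lambda>g. (g, \<mu> g)) ` L = I \<inter> (UNIV \<times> T)"
  proof (intro equalityI subsetI)
    fix z assume "z \<in> (\<lambda>g. (g, \<mu> g)) ` L"
    then obtain g where g: "g \<in> L" "z = (g, \<mu> g)"
      by blast
    then obtain k k' where k: "k \<in> K" "k' \<in> K" "\<mu> g = k ** g ** k'"
      using mu_cases L(2) by blast
    have "z = (\<lambda>(k, g, k'). (g, k ** g ** k')) (k, g, k')"
      using g k by simp
    then have "z \<in> I"
      using g k unfolding I_def by blast
    then show "z \<in> I \<inter> (UNIV \<times> T)"
      using g \<open>\<mu> \<in> L \<rightarrow> T\<close> by auto
  next
    fix z assume "z \<in> I \<inter> (UNIV \<times> T)"
    then obtain k g k' where g: "k \<in> K" "k' \<in> K" "g \<in> L" "z = (g, k ** g ** k')" "k ** g ** k' \<in> C"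
      by (auto simp: I_def T_def)
    then have "z = (g, \<mu> g)"
      using mu_eqI[of g k k'] L(2) by auto
    then show "z \<in> (\<lambda>g. (g, \<mu> g)) ` L"
      using g(3) by blast
  qed
  ultimately show "closed ((\<lambda>g. (g, \<mu> g)) ` L)"
    using T by (simp add: closed_Int closed_Times compact_imp_closed)
qed

lemma compact_mu_image: "compact L \<Longrightarrow> L \<subseteq> G \<Longrightarrow> compact (\<mu> ` L)"
  using continuous_on_mu compact_continuous_image by blast

lemma mem_K_mu_K:
  assumes "g \<in> G" "\<mu> g \<in> Q"
  shows "g \<in> K <#>\<^bsub>GL\<^esub> Q <#>\<^bsub>GL\<^esub> K"
  using mu_decomposition[OF assms(1)] assms(2) unfolding mem_set_mult3_GL by metis

text \<open>An element that is projected into \<open>Q\<close> lies in the compact set \<open>K Q K\<close>.\<close>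

lemma compact_mu_image_Int:
  assumes H: "closedin (top_of_set G) H" and Q: "compact Q" "Q \<subseteq> G"
  shows "compact (\<mu> ` H \<inter> Q)"
proof -
  define Z where "Z = K <#>\<^bsub>GL\<^esub> Q <#>\<^bsub>GL\<^esub> K"
  have Z: "compact Z"
    unfolding Z_def using Q(1) K(3) by (intro compact_mult)
  have ZG: "Z \<subseteq> G"
    unfolding Z_def using Q(2) K(2) by (intro set_mult_in_G)
  have HG: "H \<subseteq> G"
    using H closedin_subset by fastforce
  have "compact (\<mu> ` (Z \<inter> H))"
    using compact_Int_closedin[OF H Z ZG] ZG by (intro compact_mu_image) auto
  moreover have "\<mu> ` H \<inter> Q = \<mu> ` (Z \<inter> H) \<inter> Q"
    using mem_K_mu_K HG by (auto simp: Z_def)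
  ultimately show ?thesis
    using Q(1) by (simp add: compact_Int)
qed

text \<open>After absorbing elements of \<open>K\<close>, the factors \<open>l\<close> and \<open>m\<close> become \<open>torus P x\<close> and
  \<open>torus P y\<close> with \<open>x\<close> and \<open>y\<close> in a bounded part of \<open>S\<close>. Scaling \<open>x\<close> and \<open>y\<close> by \<open>s \<in> {0..1}\<close> gives a path along
  which every logarithmic coordinate of the projection stays near the finitely many coordinates of
  \<open>\<mu> g\<close>, and therefore changes only by a bounded amount between \<open>s = 0\<close> and \<open>s = 1\<close>.\<close>

lemma mu_mult_bounded:
  assumes P: "invertible P" and S: "subspace S" and CS: "C \<subseteq> torus P ` S" and SG: "torus P ` S \<subseteq> G"
    and L: "compact L" "L \<subseteq> G"
  obtains M where "compact M" "M \<subseteq> torus P ` S"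
    "\<And>g l m. g \<in> G \<Longrightarrow> l \<in> L \<Longrightarrow> m \<in> L \<Longrightarrow> \<exists>a\<in>M. \<mu> (l ** g ** m) = \<mu> g ** a"
proof -
  have muS: "\<exists>x\<in>S. \<mu> g = torus P x" if "g \<in> G" for g
    using mu_in_C[OF that] CS by blast
  have "compact (torus_log P ` \<mu> ` L)"
    using L CS mu_in_C P by (intro compact_continuous_image[OF continuous_on_torus_log] compact_mu_image) blast+
  then obtain R where R: "\<And>a. a \<in> L \<Longrightarrow> norm (torus_log P (\<mu> a)) \<le> R"
    by (metis bounded_iff compact_imp_bounded imageI)
  define Q where "Q = torus P ` (S \<inter> cball 0 R)"
  have Q: "compact Q" "Q \<subseteq> G"
    using S SG unfolding Q_def
    by (auto intro!: compact_continuous_image continuous_on_torus closed_Int_compact closed_subspace)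
  define N where "N = K <#>\<^bsub>GL\<^esub> Q <#>\<^bsub>GL\<^esub> K"
  have N: "compact N" "N \<subseteq> carrier GL"
  proof -
    show "compact N"
      unfolding N_def using Q(1) K(3) by (intro compact_mult)
    have "N \<subseteq> G"
      unfolding N_def using Q(2) K(2) by (intro set_mult_in_G)
    then show "N \<subseteq> carrier GL"
      using G_GL by blast
  qed
  have NI: "k ** torus P x ** k' \<in> N" if "k \<in> K" "k' \<in> K" "x \<in> S" "norm x \<le> R" for k k' x
  proof -
    have "torus P x \<in> Q"
      using that by (auto simp: Q_def)
    then show ?thesis
      using that unfolding N_def mem_set_mult3_GL by blast
  qed
  obtain r where r: "r \<ge> 0"
    "\<And>u w x x' i. u \<in> N \<Longrightarrow> w \<in> N \<Longrightarrow> u ** torus P x' = torus P x ** w \<Longrightarrow> \<exists>j. \<bar>x' $ i - x $ j\<bar> \<le> r"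
    using torus_entries_near[OF P N] by blast
  \<comment> \<open>the total length of \<open>n\<close> intervals of radius \<open>r\<close>\<close>
  define \<rho> where "\<rho> = 2 * r * real CARD('n)"
  define M where "M = torus P ` (S \<inter> cbox (\<chi> i. - \<rho>) (\<chi> i. \<rho>))"
  show thesis
  proof
    show "compact M"
      using S unfolding M_def
      by (intro compact_continuous_image continuous_on_torus closed_Int_compact closed_subspace compact_cbox)
    show "M \<subseteq> torus P ` S"
      by (auto simp: M_def)
    fix g l m assume g: "g \<in> G" and lm: "l \<in> L" "m \<in> L"
    have lmG: "l \<in> G" "m \<in> G"
      using lm L by auto
    obtain x where x: "x \<in> S" "\<mu> l = torus P x"
      using muS[OF lmG(1)] by blast
    obtain y where y: "y \<in> S" "\<mu> m = torus P y"
      using muS[OF lmG(2)] by blast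
    have xR: "norm x \<le> R" "norm y \<le> R"
      using R[OF lm(1)] R[OF lm(2)] x y P by simp_all
    obtain k1 k2 where k12: "k1 \<in> K" "k2 \<in> K" "l = k1 ** torus P x ** k2"
      using mu_decomposition[OF lmG(1)] x(2) by metis
    obtain k3 k4 where k34: "k3 \<in> K" "k4 \<in> K" "m = k3 ** torus P y ** k4"
      using mu_decomposition[OF lmG(2)] y(2) by metis
    define g' where "g' = k2 ** g ** k3"
    have g': "g' \<in> G" "\<mu> g' = \<mu> g"
      using g k12(2) k34(1) by (auto simp: g'_def intro: G_mult K_in_G mu_biinvariant)
    obtain x0 where x0: "x0 \<in> S" "\<mu> g = torus P x0"
      using muS[OF g] by blast
    obtain q q' where q: "q \<in> K" "q' \<in> K" "g' = q ** torus P x0 ** q'"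
      using mu_decomposition[OF g'(1)] x0(2) g'(2) by metis
    define p where "p s = torus P (s *\<^sub>R x) ** g' ** torus P (s *\<^sub>R y)" for s :: real
    have tG: "torus P z \<in> G" if "z \<in> S" for z
      using that SG by blast
    have pG: "p s \<in> G" for s
      unfolding p_def using x(1) y(1) g'(1) S by (intro G_mult tG subspace_scale)
    define h where "h s = torus_log P (\<mu> (p s))" for s
    have h: "h s \<in> S" "\<mu> (p s) = torus P (h s)" for s
      using muS[OF pG, of s] P by (auto simp: h_def)
    have near: "\<exists>j. \<bar>h s $ i - x0 $ j\<bar> \<le> r" if s: "s \<in> {0..1}" for s i
    proof -
      obtain k k' where k: "k \<in> K" "k' \<in> K" "torus P (h s) = k ** p s ** k'"
        using mu_cases[OF pG, of s] h(2) by metis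
      \<comment> \<open>multipliers with \<open>u ** \<mu> (p s) = \<mu> g ** w\<close> that stay in \<open>N\<close> for all \<open>s\<close>\<close>
      define u where "u = matrix_inv q ** torus P (- (s *\<^sub>R x)) ** matrix_inv k"
      define w where "w = q' ** torus P (s *\<^sub>R y) ** k'"
      have "s * norm x \<le> R" "s * norm y \<le> R"
        using s xR by (auto intro: order_trans[OF mult_left_le_one_le])
      then have uw: "u \<in> N" "w \<in> N"
        unfolding u_def w_def using k q s x(1) y(1) S
        by (auto intro!: NI K_inv subspace_neg subspace_scale)
      have "u ** torus P (h s) = matrix_inv q ** (torus P (- (s *\<^sub>R x)) ** (matrix_inv k ** k) ** torus P (s *\<^sub>R x))
          ** q ** torus P x0 ** w"
        by (simp only: u_def w_def k(3) p_def q(3) matrix_mul_assoc)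
      also have "\<dots> = torus P x0 ** w"
        using P k(1) q(1) by (simp add: K_invertible torus_minus invertible_torus)
      finally show ?thesis
        using r(2) uw by blast
    qed
    have conth: "continuous_on {0..1} h"
    proof -
      have contp: "continuous_on {0..1} p"
      proof -
        have "continuous_on {0..1} (\<lambda>s. torus P (s *\<^sub>R z))" for z
          by (rule continuous_on_compose2[OF continuous_on_torus[of UNIV]]) (auto intro!: continuous_intros)
        then show ?thesis
          unfolding p_def[abs_def] by (intro continuous_intros)
      qed
      then have "compact (p ` {0..1})"
        by (intro compact_continuous_image) auto
      then have "continuous_on (p ` {0..1}) \<mu>"
        using pG by (intro continuous_on_mu) auto
      then have "continuous_on {0..1} (\<lambda>s. \<mu> (p s))"
        using contp continuous_on_compose2 by blast
      moreover have "continuous_on (range (torus P)) (torus_log P)"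
        using P by (intro continuous_on_torus_log) auto
      ultimately show ?thesis
        unfolding h_def[abs_def] using h(2) by (elim continuous_on_compose2) auto
    qed
    have "\<bar>h 1 $ i - h 0 $ i\<bar> \<le> \<rho>" for i
      unfolding \<rho>_def
    proof (rule connected_near_finite_set_bound[where T = "(\<lambda>s. h s $ i) ` {0..1}" and I = UNIV and p = "\<lambda>j. x0 $ j"])
      show "connected ((\<lambda>s. h s $ i) ` {0..1})"
        using conth by (intro connected_continuous_image continuous_intros) auto
      show "(\<lambda>s. h s $ i) ` {0..1} \<subseteq> (\<Union>j\<in>UNIV. {x0 $ j - r..x0 $ j + r})"
      proof clarify
        fix s :: real assume "s \<in> {0..1}"
        then obtain j where "\<bar>h s $ i - x0 $ j\<bar> \<le> r"
          using near by blast
        then have "h s $ i \<in> {x0 $ j - r..x0 $ j + r}"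
          by (auto simp: abs_le_iff)
        then show "h s $ i \<in> (\<Union>j\<in>UNIV. {x0 $ j - r..x0 $ j + r})"
          by blast
      qed
    qed (use r(1) in auto)
    then have "- \<rho> \<le> (h 1 - h 0) $ i \<and> (h 1 - h 0) $ i \<le> \<rho>" for i
      unfolding vector_minus_component by (meson abs_le_D1 abs_le_D2 minus_le_iff)
    then have "h 1 - h 0 \<in> S \<inter> cbox (\<chi> i. - \<rho>) (\<chi> i. \<rho>)"
      using h(1) S by (simp add: subspace_diff mem_box_cart)
    then have "torus P (h 1 - h 0) \<in> M"
      by (simp add: M_def)
    moreover have "\<mu> (l ** g ** m) = \<mu> g ** torus P (h 1 - h 0)"
    proof -
      have "p 0 = g'"
        using P by (simp add: p_def torus_zero)
      then have "h 0 = x0"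
        using g'(2) x0(2) P by (simp add: h_def)
      have "l ** g ** m = k1 ** p 1 ** k4"
        by (simp add: k12(3) k34(3) p_def g'_def matrix_mul_assoc)
      then have "\<mu> (l ** g ** m) = \<mu> (p 1)"
        using mu_biinvariant[OF pG] k12(1) k34(2) by simp
      also have "\<dots> = torus P (h 0 + (h 1 - h 0))"
        by (simp add: h(2))
      also have "\<dots> = torus P (h 0) ** torus P (h 1 - h 0)"
        using P by (rule torus_add)
      finally show ?thesis
        using x0(2) \<open>h 0 = x0\<close> by simp
    qed
    ultimately show "\<exists>a\<in>M. \<mu> (l ** g ** m) = \<mu> g ** a"
      by blast
  qed
qed



lemma inv_image_in_G: "X \<subseteq> G \<Longrightarrow> matrix_inv ` X \<subseteq> G"
  using G_inv by blast

lemma compact_inv_image: "compact X \<Longrightarrow> X \<subseteq> G \<Longrightarrow> compact (matrix_inv ` X)"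
  using G_GL by (intro compact_inv) auto

lemma mult_invs [simp]:
  assumes "x \<in> G"
  shows "matrix_inv x ** (x ** y) = y" "x ** (matrix_inv x ** y) = y"
    "y ** x ** matrix_inv x = y" "y ** matrix_inv x ** x = y"
proof -
  show "matrix_inv x ** (x ** y) = y" "x ** (matrix_inv x ** y) = y"
    using G_invertible[OF assms] by (simp_all add: matrix_mul_assoc)
  show "y ** x ** matrix_inv x = y" "y ** matrix_inv x ** x = y"
    using G_invertible[OF assms] by (simp_all flip: matrix_mul_assoc)
qed

text \<open>If \<open>\<mu> h1 = \<mu> h2 ** m\<close>, then \<open>h1\<close> lies in \<open>K h2 (K m K)\<close>, so it belongs to the set \<open>T\<close> that is
  compact by properness, and \<open>\<mu> h2 = \<mu> h1 ** matrix_inv m\<close> belongs to a compact set \<open>Q\<close>. This describes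
  the intersection by images and products of compact sets.\<close>

lemma compact_mu_intersection_if_proper:
  assumes H: "H1 \<subseteq> G" "closedin (top_of_set G) H2"
    and proper: "\<And>L. compact L \<Longrightarrow> L \<subseteq> G \<Longrightarrow> compact (H1 \<inter> (L <#>\<^bsub>GL\<^esub> H2 <#>\<^bsub>GL\<^esub> matrix_inv ` L))"
    and M: "compact M" "M \<subseteq> G"
  shows "compact (\<mu> ` H1 \<inter> (\<mu> ` H2 <#>\<^bsub>GL\<^esub> M))"
proof -
  \<comment> \<open>the second part is inverted because \<open>L\<close> enters on the right through its inverses\<close>
  define L where "L = K \<union> matrix_inv ` (K <#>\<^bsub>GL\<^esub> M <#>\<^bsub>GL\<^esub> K)"
  have KMK: "compact (K <#>\<^bsub>GL\<^esub> M <#>\<^bsub>GL\<^esub> K)" "K <#>\<^bsub>GL\<^esub> M <#>\<^bsub>GL\<^esub> K \<subseteq> G"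
    using M K(2,3) by (simp_all add: compact_mult set_mult_in_G)
  have L: "compact L" "L \<subseteq> G"
    using KMK K(2,3) unfolding L_def by (simp_all add: compact_Un compact_inv_image inv_image_in_G)
  have H2G: "H2 \<subseteq> G"
    using H(2) closedin_imp_subset by blast
  define T where "T = H1 \<inter> (L <#>\<^bsub>GL\<^esub> H2 <#>\<^bsub>GL\<^esub> matrix_inv ` L)"
  have T: "compact T" "T \<subseteq> G"
    using proper[OF L] H(1) by (auto simp: T_def)
  have muT: "compact (\<mu> ` T)" "\<mu> ` T \<subseteq> G"
    using T mu_in_G by (auto intro: compact_mu_image)
  define Q where "Q = \<mu> ` T <#>\<^bsub>GL\<^esub> matrix_inv ` M"
  have "compact Q" "Q \<subseteq> G"
    unfolding Q_def using M muT by (simp_all add: compact_mult compact_inv_image inv_image_in_G set_mult_in_G)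
  then have "compact (\<mu> ` T \<inter> ((\<mu> ` H2 \<inter> Q) <#>\<^bsub>GL\<^esub> M))"
    using muT M by (intro compact_Int compact_mult compact_mu_image_Int H(2))
  moreover have "\<mu> ` H1 \<inter> (\<mu> ` H2 <#>\<^bsub>GL\<^esub> M) = \<mu> ` T \<inter> ((\<mu> ` H2 \<inter> Q) <#>\<^bsub>GL\<^esub> M)"
  proof (intro equalityI subsetI)
    fix z assume "z \<in> \<mu> ` H1 \<inter> (\<mu> ` H2 <#>\<^bsub>GL\<^esub> M)"
    then obtain h1 h2 m where h: "h1 \<in> H1" "h2 \<in> H2" "m \<in> M" "z = \<mu> h1" "z = \<mu> h2 ** m"
      by (auto simp: mem_set_mult_GL)
    obtain k1 k2 where k12: "k1 \<in> K" "k2 \<in> K" "h1 = k1 ** \<mu> h1 ** k2"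
      using mu_decomposition h(1) H(1) by blast
    obtain k3 k4 where k34: "k3 \<in> K" "k4 \<in> K" "\<mu> h2 = k3 ** h2 ** k4"
      using mu_cases h(2) H2G by blast
    have mem: "k4 ** m ** k2 \<in> K <#>\<^bsub>GL\<^esub> M <#>\<^bsub>GL\<^esub> K"
      using k34(2) h(3) k12(2) unfolding mem_set_mult3_GL by blast
    have "h1 = (k1 ** k3) ** h2 ** (k4 ** m ** k2)"
      using k12(3) h(4,5) k34(3) by (metis matrix_mul_assoc)
    also have "k4 ** m ** k2 = matrix_inv (matrix_inv (k4 ** m ** k2))"
    proof -
      have "invertible (k4 ** m ** k2)"
        using mem KMK(2) G_invertible by blast
      then show ?thesis
        by (intro matrix_inv_unique[symmetric]) simp
    qed
    finally have "h1 = (k1 ** k3) ** h2 ** matrix_inv (matrix_inv (k4 ** m ** k2))" .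
    moreover have "k1 ** k3 \<in> L" "matrix_inv (k4 ** m ** k2) \<in> L"
      using k12 k34 mem by (auto simp: L_def K_mult)
    ultimately have "h1 \<in> T"
      unfolding T_def Int_iff mem_set_mult3_GL using h(1,2) by blast
    moreover have "\<mu> h2 = z ** matrix_inv m"
      using h(3,5) M(2) by auto
    ultimately have "\<mu> h2 \<in> Q"
      using h(3,4) unfolding Q_def mem_set_mult_GL by blast
    then show "z \<in> \<mu> ` T \<inter> ((\<mu> ` H2 \<inter> Q) <#>\<^bsub>GL\<^esub> M)"
      using h \<open>h1 \<in> T\<close> unfolding Int_iff mem_set_mult_GL by blast
  qed (auto simp: T_def mem_set_mult_GL)
  ultimately show ?thesis
    by simp
qed

text \<open>If \<open>h = l ** k ** matrix_inv l'\<close>, then \<open>\<mu> h\<close> lies in \<open>\<mu> k ** M\<close> with \<open>M\<close> from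
  \<open>mu_mult_bounded\<close>, hence in a compact set. So \<open>h\<close> is confined to a compact set \<open>Z\<close> and
  \<open>k = matrix_inv l ** h ** l'\<close> to a compact set \<open>Y\<close>.\<close>

lemma proper_if_compact_mu_intersections:
  assumes P: "invertible P" and S: "subspace S" and CS: "C \<subseteq> torus P ` S" and SG: "torus P ` S \<subseteq> G"
    and H: "closedin (top_of_set G) H1" "closedin (top_of_set G) H2"
    and mu: "\<And>M. compact M \<Longrightarrow> M \<subseteq> torus P ` S \<Longrightarrow> compact (\<mu> ` H1 \<inter> (\<mu> ` H2 <#>\<^bsub>GL\<^esub> M))"
    and L: "compact L" "L \<subseteq> G"
  shows "compact (H1 \<inter> (L <#>\<^bsub>GL\<^esub> H2 <#>\<^bsub>GL\<^esub> matrix_inv ` L))"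
proof -
  have HG: "H1 \<subseteq> G" "H2 \<subseteq> G"
    using H closedin_imp_subset by blast+
  have "compact (L \<union> matrix_inv ` L)" "L \<union> matrix_inv ` L \<subseteq> G"
    using L by (simp_all add: compact_Un compact_inv_image inv_image_in_G)
  from mu_mult_bounded[OF P S CS SG this] obtain M where M: "compact M" "M \<subseteq> torus P ` S"
    and bound: "\<And>g l m. g \<in> G \<Longrightarrow> l \<in> L \<union> matrix_inv ` L \<Longrightarrow> m \<in> L \<union> matrix_inv ` L \<Longrightarrow>
      \<exists>a\<in>M. \<mu> (l ** g ** m) = \<mu> g ** a"
    by metis
  define E where "E = \<mu> ` H1 \<inter> (\<mu> ` H2 <#>\<^bsub>GL\<^esub> M)"
  have E: "compact E" "E \<subseteq> G"
    using mu[OF M] HG(1) mu_in_G by (auto simp: E_def)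
  define Z where "Z = K <#>\<^bsub>GL\<^esub> E <#>\<^bsub>GL\<^esub> K"
  have Z: "compact Z" "Z \<subseteq> G"
    using E K(2,3) unfolding Z_def by (simp_all add: compact_mult set_mult_in_G)
  define Y where "Y = matrix_inv ` L <#>\<^bsub>GL\<^esub> Z <#>\<^bsub>GL\<^esub> L"
  have Y: "compact Y" "Y \<subseteq> G"
    using Z L unfolding Y_def
    by (simp_all add: compact_mult set_mult_in_G compact_inv_image inv_image_in_G)
  have "compact (L <#>\<^bsub>GL\<^esub> (Y \<inter> H2) <#>\<^bsub>GL\<^esub> matrix_inv ` L)"
    using compact_Int_closedin[OF H(2) Y] L by (simp add: compact_mult compact_inv_image)
  then have "compact ((Z \<inter> H1) \<inter> (L <#>\<^bsub>GL\<^esub> (Y \<inter> H2) <#>\<^bsub>GL\<^esub> matrix_inv ` L))"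
    by (rule compact_Int[OF compact_Int_closedin[OF H(1) Z]])
  moreover have "H1 \<inter> (L <#>\<^bsub>GL\<^esub> H2 <#>\<^bsub>GL\<^esub> matrix_inv ` L)
      = (Z \<inter> H1) \<inter> (L <#>\<^bsub>GL\<^esub> (Y \<inter> H2) <#>\<^bsub>GL\<^esub> matrix_inv ` L)"
  proof (intro equalityI subsetI)
    fix h assume "h \<in> H1 \<inter> (L <#>\<^bsub>GL\<^esub> H2 <#>\<^bsub>GL\<^esub> matrix_inv ` L)"
    then obtain l k l' where h: "h \<in> H1" "l \<in> L" "k \<in> H2" "l' \<in> L" "h = l ** k ** matrix_inv l'"
      unfolding Int_iff mem_set_mult3_GL by blast
    obtain a where a: "a \<in> M" "\<mu> h = \<mu> k ** a"
      using bound[of k l "matrix_inv l'"] h HG by blast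
    then have "\<mu> h \<in> E"
      using h(1,3) unfolding E_def Int_iff mem_set_mult_GL by blast
    then have hZ: "h \<in> Z"
      unfolding Z_def using h(1) HG(1) by (intro mem_K_mu_K) auto
    have "matrix_inv l ** h ** l' = matrix_inv l ** (l ** k ** matrix_inv l' ** l')"
      by (simp add: h(5) matrix_mul_assoc)
    also have "\<dots> = k"
      using h(2,4) L(2) by (simp add: subset_iff)
    finally have "k \<in> Y"
      using h(2,4) hZ unfolding Y_def mem_set_mult3_GL by blast
    then show "h \<in> (Z \<inter> H1) \<inter> (L <#>\<^bsub>GL\<^esub> (Y \<inter> H2) <#>\<^bsub>GL\<^esub> matrix_inv ` L)"
      using h hZ unfolding Int_iff mem_set_mult3_GL by blast
  next
    fix h assume "h \<in> (Z \<inter> H1) \<inter> (L <#>\<^bsub>GL\<^esub> (Y \<inter> H2) <#>\<^bsub>GL\<^esub> matrix_inv ` L)"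
    then show "h \<in> H1 \<inter> (L <#>\<^bsub>GL\<^esub> H2 <#>\<^bsub>GL\<^esub> matrix_inv ` L)"
      unfolding Int_iff mem_set_mult3_GL by blast
  qed
  ultimately show ?thesis
    by simp
qed

end

section \<open>The properness criterion\<close>

theorem proposition1p5:
  fixes G A K H1 H2 :: "(real^'n^'n) set"
    and \<Sigma>p :: "(real^'n^'n \<Rightarrow> real) set"
    and \<mu> :: "real^'n^'n \<Rightarrow> real^'n^'n"
  assumes "connected_linear_semisimple_group G"
    and "cartan_subspace G A"
    and "positive_roots G A \<Sigma>p"
    and "maximal_compact_subgroup G K"
    and "cartan_decomposition G K (weyl_chamber A \<Sigma>p)"
    and "cartan_projection G K (weyl_chamber A \<Sigma>p) \<mu>"
    and "closed_subgroup H1 G"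
    and "closed_subgroup H2 G"
  shows "acts_properly G H1 H2 \<longleftrightarrow>
    (\<forall>M. M \<subseteq> A \<and> compact M \<longrightarrow> compact (\<mu> ` H1 \<inter> (\<mu> ` H2 <#>\<^bsub>GL\<^esub> M)))"
proof -
  have G: "subgroup G GL" "closedin (top_of_set (carrier GL)) G"
    using assms(1) by (auto simp: connected_linear_semisimple_group_def)
  obtain P S where P: "invertible P" and S: "subspace S" and A: "A = torus P ` S"
    using cartan_subspace_torus[OF G assms(2)] .
  have AG: "A \<subseteq> G" "\<forall>a\<in>A. invertible a"
    using assms(2) by (auto simp: cartan_subspace_def connected_abelian_hyperbolic_def subgroup_GL_iff)
  have CA: "weyl_chamber A \<Sigma>p \<subseteq> A"
    by (auto simp: weyl_chamber_def)
  have "closedin (top_of_set (carrier GL)) A"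
    unfolding A using P S by (intro closedin_torus_image closed_subspace)
  then have "closedin (top_of_set (carrier GL)) (weyl_chamber A \<Sigma>p)"
    using closedin_weyl_chamber AG(2) assms(3) by blast
  then interpret group_with_cartan_projection G K "weyl_chamber A \<Sigma>p" \<mu>
    using G assms(4,6) CA AG(1)
    by (intro group_with_cartan_projection.intro) (auto simp: maximal_compact_subgroup_def)
  have H: "H1 \<subseteq> G" "closedin (top_of_set G) H1" "closedin (top_of_set G) H2"
    using assms(7,8) by (auto simp: closed_subgroup_def)
  show ?thesis
    unfolding acts_properly_iff[OF G H(1) assms(8)]
  proof (intro iffI allI impI; elim conjE)
    fix M
    assume "\<forall>L. compact L \<and> L \<subseteq> G \<longrightarrow> compact (H1 \<inter> (L <#>\<^bsub>GL\<^esub> H2 <#>\<^bsub>GL\<^esub> matrix_inv ` L))"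
      and "M \<subseteq> A" "compact M"
    then show "compact (\<mu> ` H1 \<inter> (\<mu> ` H2 <#>\<^bsub>GL\<^esub> M))"
      using AG(1) by (intro compact_mu_intersection_if_proper H(1,3)) auto
  next
    fix L
    assume "\<forall>M. M \<subseteq> A \<and> compact M \<longrightarrow> compact (\<mu> ` H1 \<inter> (\<mu> ` H2 <#>\<^bsub>GL\<^esub> M))"
      and "compact L" "L \<subseteq> G"
    then show "compact (H1 \<inter> (L <#>\<^bsub>GL\<^esub> H2 <#>\<^bsub>GL\<^esub> matrix_inv ` L))"
      using A AG(1) CA by (intro proper_if_compact_mu_intersections[OF P S _ _ H(2,3)]) auto
  qed
qed

end
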